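(* Let $G$ be a maximal outerplanar graph. Then $G$ is in $B_0$ if and only if $G$ does not contain an induced subgraph isomorphic to $S_3$.
   Context: A graph is maximal outerplanar if it is outerplanar and adding any single new edge yields a non-outerplanar graph. $S_3$ is the graph with vertices $x_1,x_2,x_3,y_1,y_2,y_3$ and edges $\{x_1,x_2\},\{x_1,x_3\},\{x_2,x_3\},\{x_1,y_1\},\{x_2,y_1\},\{x_2,y_2\},\{x_3,y_2\},\{x_3,y_3\},\{x_1,y_3\}$. An EPG representation of a graph is a set of paths on a rectangular grid (sequences of grid points joined consecutively by grid edges), one per vertex, such that two vertices are adjacent iff their paths share a grid edge. $B_0$ is the class of graphs having an EPG representation in which no path has a bend (every path lies on a single grid line). *)

theory Defs
  imports "HOL-Analysis.Analysis"
begin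

definition simple_graph :: "'a set \<Rightarrow> 'a set set \<Rightarrow> bool" where
  "simple_graph V E \<longleftrightarrow> finite V \<and>
     (\<forall>e\<in>E. \<exists>u v. u \<in> V \<and> v \<in> V \<and> u \<noteq> v \<and> e = {u, v})"

definition planar_drawing ::
  "'a set \<Rightarrow> 'a set set \<Rightarrow> ('a \<Rightarrow> complex) \<Rightarrow> ('a set \<Rightarrow> real \<Rightarrow> complex) \<Rightarrow> bool" where
  "planar_drawing V E pos \<gamma> \<longleftrightarrow>
     inj_on pos V \<and>
     (\<forall>e\<in>E. arc (\<gamma> e) \<and> pos ` e = {pathstart (\<gamma> e), pathfinish (\<gamma> e)}) \<and>
     (\<forall>e\<in>E. \<forall>w\<in>V. pos w \<in> path_image (\<gamma> e) \<longrightarrow> w \<in> e) \<and>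
     (\<forall>e\<in>E. \<forall>e'\<in>E. e \<noteq> e' \<longrightarrow>
         path_image (\<gamma> e) \<inter> path_image (\<gamma> e') \<subseteq> pos ` (e \<inter> e'))"

text \<open>Outerplanar: there is a planar drawing with every vertex on the boundary of the
  outer (unbounded) face, i.e. in the closure of the outside of the drawing.\<close>
definition outerplanar :: "'a set \<Rightarrow> 'a set set \<Rightarrow> bool" where
  "outerplanar V E \<longleftrightarrow> simple_graph V E \<and>
     (\<exists>pos \<gamma>. planar_drawing V E pos \<gamma> \<and>
        (\<forall>v\<in>V. pos v \<in> closure (outside (pos ` V \<union> (\<Union>e\<in>E. path_image (\<gamma> e))))))"

definition maximal_outerplanar :: "'a set \<Rightarrow> 'a set set \<Rightarrow> bool" where
  "maximal_outerplanar V E \<longleftrightarrow> outerplanar V E \<and>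
     (\<forall>u\<in>V. \<forall>v\<in>V. u \<noteq> v \<longrightarrow> {u, v} \<notin> E \<longrightarrow> \<not> outerplanar V (insert {u, v} E))"

text \<open>The graph S_3 on vertices 0,1,2 (= x1,x2,x3) and 3,4,5 (= y1,y2,y3).\<close>
definition S3_V :: "nat set" where "S3_V = {0,1,2,3,4,5}"
definition S3_E :: "nat set set" where
  "S3_E = {{0,1},{0,2},{1,2},{0,3},{1,3},{1,4},{2,4},{2,5},{0,5}}"

definition has_induced_copy :: "'b set \<Rightarrow> 'b set set \<Rightarrow> 'a set \<Rightarrow> 'a set set \<Rightarrow> bool" where
  "has_induced_copy VH EH V E \<longleftrightarrow>
     (\<exists>f. inj_on f VH \<and> f ` VH \<subseteq> V \<and>
        (\<forall>a\<in>VH. \<forall>b\<in>VH. a \<noteq> b \<longrightarrow> ({f a, f b} \<in> E \<longleftrightarrow> {a, b} \<in> EH)))"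

type_synonym gpoint = "int \<times> int"

definition grid_adj :: "gpoint \<Rightarrow> gpoint \<Rightarrow> bool" where
  "grid_adj p q \<longleftrightarrow> \<bar>fst p - fst q\<bar> + \<bar>snd p - snd q\<bar> = 1"

definition grid_path :: "gpoint list \<Rightarrow> bool" where
  "grid_path P \<longleftrightarrow> P \<noteq> [] \<and> distinct P \<and>
     (\<forall>i. Suc i < length P \<longrightarrow> grid_adj (P ! i) (P ! Suc i))"

definition path_edges :: "gpoint list \<Rightarrow> gpoint set set" where
  "path_edges P = {{P ! i, P ! Suc i} | i. Suc i < length P}"

definition bendless :: "gpoint list \<Rightarrow> bool" where
  "bendless P \<longleftrightarrow> (\<exists>c. \<forall>p\<in>set P. fst p = c) \<or> (\<exists>c. \<forall>p\<in>set P. snd p = c)"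

definition EPG_rep :: "'a set \<Rightarrow> 'a set set \<Rightarrow> ('a \<Rightarrow> gpoint list) \<Rightarrow> bool" where
  "EPG_rep V E P \<longleftrightarrow> (\<forall>v\<in>V. grid_path (P v)) \<and>
     (\<forall>u\<in>V. \<forall>v\<in>V. u \<noteq> v \<longrightarrow>
        ({u, v} \<in> E \<longleftrightarrow> path_edges (P u) \<inter> path_edges (P v) \<noteq> {}))"

definition in_B0 :: "'a set \<Rightarrow> 'a set set \<Rightarrow> bool" where
  "in_B0 V E \<longleftrightarrow> (\<exists>P. EPG_rep V E P \<and> (\<forall>v\<in>V. bendless (P v)))"

end

theory Submission
  imports Defs
begin

text \<open>In a drawing with all vertices on the outer face, Janiszewski's theorem shows that one arc of any theta
  graph lies inside the cycle of the other two. Hence such a drawing contains neither a subdivided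
  \<open>K\<^bsub>2,3\<^esub>\<close> nor a cycle with two crossing chords. A graph without these has a linear order in which no
  two edges cross: split it at separations of order at most one; otherwise a longest cycle is
  Hamiltonian, since an ear would extend it or create a theta. Conversely such an order gives a straight
  line drawing on a parabola. So a maximal outerplanar graph is a triangulated polygon.
  Without induced \<open>S\<^sub>3\<close> it has no triangle of three diagonals, so the triangles on either side of a
  triangle on the hull form a strip, and segments are added one vertex at a time.
  In the other direction, the degree two vertices of \<open>S\<^sub>3\<close> form an asteroidal triple.\<close>

section \<open>Theta graphs in the plane\<close>

text \<open>The hypothesis speaks of arbitrary arcs in the plane, the interval argument needs a
  polygon. A noncrossing order mediates because it can be reached from both sides: the excluded
  subgraphs force it, and it yields a drawing. Maximality enters through this round trip. A missing
  chord that crosses no edge could be added without spoiling the order, and the larger graph would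
  still be outerplanar. So a chord is absent only if some edge crosses it, and no faces have to be
  formed: triangles are found by choosing extremal neighbours. A line has only two ends, whereas a
  triangle with a neighbour on all three sides would need three directions in which to continue. The
  root triangle is therefore taken at a hull edge, and the strips behind its other two sides run off
  to the left and to the right.\<close>

lemma Jordan_arc_pair:
  fixes c1 c2 :: "real \<Rightarrow> complex"
  assumes "arc c1" "pathstart c1 = a" "pathfinish c1 = b"
    and "arc c2" "pathstart c2 = a" "pathfinish c2 = b"
    and "path_image c1 \<inter> path_image c2 = {a, b}"
  shows "inside (path_image c1 \<union> path_image c2) \<noteq> {}"
    and "open (inside (path_image c1 \<union> path_image c2))"
    and "connected (inside (path_image c1 \<union> path_image c2))"
    and "frontier (inside (path_image c1 \<union> path_image c2)) = path_image c1 \<union> path_image c2"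
proof -
  let ?g = "c1 +++ reversepath c2"
  have "simple_path ?g"
    by (rule simple_path_join_loop) (use assms in \<open>auto simp: arc_reversepath\<close>)
  moreover have "pathfinish ?g = pathstart ?g"
    using assms by simp
  moreover have "path_image ?g = path_image c1 \<union> path_image c2"
    using assms by (simp add: path_image_join)
  ultimately show "inside (path_image c1 \<union> path_image c2) \<noteq> {}"
    and "open (inside (path_image c1 \<union> path_image c2))"
    and "connected (inside (path_image c1 \<union> path_image c2))"
    and "frontier (inside (path_image c1 \<union> path_image c2)) = path_image c1 \<union> path_image c2"
    using Jordan_inside_outside[of ?g] by auto
qed

lemma connected_subset_outside:
  assumes "connected S" "S \<inter> T = {}" "x \<in> S" "x \<in> outside T"
  shows "S \<subseteq> outside T"
proof
  fix y assume "y \<in> S"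
  then have "connected_component (- T) x y"
    unfolding connected_component_def using assms by (intro exI[of _ S]) auto
  then show "y \<in> outside T"
    using assms outside_same_component by blast
qed

lemma connected_subset_inside:
  assumes "connected S" "S \<inter> T = {}" "x \<in> S" "x \<in> inside T"
  shows "S \<subseteq> inside T"
proof
  fix y assume y: "y \<in> S"
  show "y \<in> inside T"
  proof (rule ccontr)
    assume "y \<notin> inside T"
    then have "y \<in> outside T"
      using y assms(2) inside_Un_outside[of T] by blast
    then have "x \<in> outside T"
      using connected_subset_outside[OF assms(1,2) y] assms(3) by blast
    then show False
      using assms(4) inside_Int_outside[of T] by blast
  qed
qed

text \<open>The open set \<open>inside S\<close> is disjoint from \<open>outside T\<close>, hence
  from its closure. Every use of the outer-face condition passes through this: no vertex lies inside
  a cycle of the drawing.\<close>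

lemma inside_not_in_closure_outside:
  assumes "S \<subseteq> T" "open (inside S)" "x \<in> inside S"
  shows "x \<notin> closure (outside T)"
proof -
  have "inside S \<inter> outside T = {}"
    using outside_mono[OF assms(1)] inside_Int_outside[of S] by blast
  then have "inside S \<inter> closure (outside T) = {}"
    using assms(2) open_Int_closure_eq_empty by blast
  then show ?thesis using assms(3) by blast
qed

text \<open>The assumptions are symmetric in the three arcs, so a fact is proved for one arc and
  transferred to the others by \<open>permute\<close>.\<close>

locale theta =
  fixes c1 c2 c3 :: "real \<Rightarrow> complex" and a b :: complex
  assumes arcs: "arc c1" "arc c2" "arc c3"
    and ends: "pathstart c1 = a" "pathfinish c1 = b" "pathstart c2 = a" "pathfinish c2 = b"
      "pathstart c3 = a" "pathfinish c3 = b"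
    and disj: "path_image c1 \<inter> path_image c2 = {a, b}" "path_image c1 \<inter> path_image c3 = {a, b}"
      "path_image c2 \<inter> path_image c3 = {a, b}"
begin

lemma permute: "theta c1 c3 c2 a b" "theta c2 c1 c3 a b" "theta c2 c3 c1 a b"
  using arcs ends disj by (unfold_locales; auto)+

lemma neq: "a \<noteq> b"
  using arc_distinct_ends[OF arcs(1)] ends by auto

lemma interior_connected: "connected (path_image c3 - {a, b})"
  using connected_simple_path_endless[OF arc_imp_simple_path[OF arcs(3)]] ends by simp

lemma interior_nonempty: "path_image c3 - {a, b} \<noteq> {}"
  using simple_path_endless[OF arc_imp_simple_path[OF arcs(3)]] ends by auto

lemmas jordan12 = Jordan_arc_pair[OF arcs(1) ends(1,2) arcs(2) ends(3,4) disj(1)]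

lemma interior_inside:
  assumes "path_image c3 \<inter> inside (path_image c1 \<union> path_image c2) \<noteq> {}"
  shows "path_image c3 - {a, b} \<subseteq> inside (path_image c1 \<union> path_image c2)"
proof -
  let ?J = "path_image c1 \<union> path_image c2"
  obtain x where x: "x \<in> path_image c3" "x \<in> inside ?J" using assms by blast
  have "{a, b} \<subseteq> ?J" using disj by auto
  then have "x \<in> path_image c3 - {a, b}"
    using x inside_no_overlap[of ?J] by blast
  then show ?thesis
    using connected_subset_inside[OF interior_connected _ _ x(2)] disj by blast
qed

text \<open>If c1 is not inside the curve of the other two arcs, then the Jordan domain of
  c1 and c2 spills over c1 to the outside of that curve.\<close>
lemma inside_subset_outside:
  assumes "path_image c3 \<inter> inside (path_image c1 \<union> path_image c2) = {}"
    and "path_image c1 \<inter> inside (path_image c2 \<union> path_image c3) = {}"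
  shows "inside (path_image c1 \<union> path_image c2) \<subseteq> outside (path_image c2 \<union> path_image c3)"
proof -
  let ?A = "inside (path_image c1 \<union> path_image c2)" and ?T = "path_image c2 \<union> path_image c3"
  let ?I = "path_image c1 - {a, b}"
  have ne: "?I \<noteq> {}" using theta.interior_nonempty[OF permute(3)] .
  \<comment> \<open>Adding points of its closure keeps a connected set connected; the enlarged set
    contains points of \<open>c1\<close>, which lie outside the other curve.\<close>
  have "?I \<subseteq> closure ?A"
    using jordan12(4) by (auto simp: closure_Un_frontier)
  then have con: "connected (?A \<union> ?I)"
    using connected_intermediate_closure[OF jordan12(3)] closure_subset[of ?A] by (metis Un_least Un_upper1)
  have "?A \<inter> ?T = {}"
    using assms(1) inside_no_overlap[of "path_image c1 \<union> path_image c2"] by blast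
  moreover have I: "?I \<inter> ?T = {}" using disj by blast
  ultimately have "(?A \<union> ?I) \<inter> ?T = {}" by blast
  moreover obtain x where x: "x \<in> ?I" using ne by blast
  moreover have "x \<in> outside ?T"
    using x I assms(2) inside_Un_outside[of ?T] by blast
  ultimately have "?A \<union> ?I \<subseteq> outside ?T"
    using connected_subset_outside[OF con] by blast
  then show ?thesis by blast
qed

text \<open>Otherwise a point inside the curve of \<open>c1\<close> and \<open>c2\<close> is outside
  both other curves, by \<open>inside_subset_outside\<close>. Those two curves meet in the connected
  set \<open>path_image c3\<close>, so by Janiszewski's theorem their union does not cut the point
  off from the outside either. But this union contains the curve that encloses the point.\<close>

lemma middle_arc:
  "path_image c1 \<inter> inside (path_image c2 \<union> path_image c3) \<noteq> {} \<or>
   path_image c2 \<inter> inside (path_image c1 \<union> path_image c3) \<noteq> {} \<or>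
   path_image c3 \<inter> inside (path_image c1 \<union> path_image c2) \<noteq> {}"
proof (rule ccontr)
  assume "\<not> ?thesis"
  then have n1: "path_image c1 \<inter> inside (path_image c2 \<union> path_image c3) = {}"
    and n2: "path_image c2 \<inter> inside (path_image c1 \<union> path_image c3) = {}"
    and n3: "path_image c3 \<inter> inside (path_image c1 \<union> path_image c2) = {}" by auto
  let ?S = "path_image c1 \<union> path_image c3" and ?T = "path_image c2 \<union> path_image c3"
  let ?J = "path_image c1 \<union> path_image c2"
  obtain x where x: "x \<in> inside ?J" using jordan12(1) by blast
  have xT: "x \<in> outside ?T" using inside_subset_outside[OF n3 n1] x by blast
  have xS: "x \<in> outside ?S"
    using theta.inside_subset_outside[OF permute(2)] n2 n3 x by (auto simp: Un_commute)
  have comp: "compact (?S \<union> ?T)" "compact ?S" "compact ?T"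
    using arcs by (auto intro!: compact_Un compact_arc_image)
  have "outside (?S \<union> ?T) \<noteq> {}"
    using outside_bounded_nonempty[OF compact_imp_bounded[OF comp(1)]] .
  then obtain y where y: "y \<in> outside (?S \<union> ?T)" by blast
  have conn: "connected (outside ?S)" "connected (outside ?T)"
    using connected_outside compact_imp_bounded comp by (metis DIM_complex order_refl)+
  have "y \<in> outside ?S" "y \<in> outside ?T"
    using y outside_mono[of ?S "?S \<union> ?T"] outside_mono[of ?T "?S \<union> ?T"] by auto
  then have cS: "connected_component (- ?S) x y" and cT: "connected_component (- ?T) x y"
    using conn xS xT outside_no_overlap[of ?S] outside_no_overlap[of ?T]
    unfolding connected_component_def by blast+
  have "?S \<inter> ?T = path_image c3" using disj by auto
  then have "connected (?S \<inter> ?T)" using arcs by (simp add: connected_arc_image)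
  then have "connected_component (- (?S \<union> ?T)) x y"
    using Janiszewski[OF comp(2) compact_imp_closed[OF comp(3)] _ cS cT] by blast
  then have "x \<in> outside (?S \<union> ?T)"
    using y outside_same_component connected_component_sym by blast
  moreover have "?J \<subseteq> ?S \<union> ?T" by blast
  ultimately have "x \<in> outside ?J" using outside_mono by blast
  then show False using x inside_Int_outside by blast
qed

lemma not_in_closure_outside:
  assumes "path_image c1 \<union> path_image c2 \<union> path_image c3 \<subseteq> X"
    and "w \<in> path_image c3 - {a, b}" "w \<in> closure (outside X)"
  shows "path_image c3 \<inter> inside (path_image c1 \<union> path_image c2) = {}"
proof (rule ccontr)
  assume "\<not> ?thesis"
  then have "w \<in> inside (path_image c1 \<union> path_image c2)"
    using interior_inside assms(2) by blast
  then show False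
    using inside_not_in_closure_outside[OF _ jordan12(2)] assms(1,3) by blast
qed

lemma third_arc_inside:
  assumes "path_image c1 \<union> path_image c2 \<union> path_image c3 \<subseteq> X"
    and "w1 \<in> path_image c1 - {a, b}" "w1 \<in> closure (outside X)"
    and "w2 \<in> path_image c2 - {a, b}" "w2 \<in> closure (outside X)"
  shows "path_image c3 \<inter> inside (path_image c1 \<union> path_image c2) \<noteq> {}"
  using middle_arc theta.not_in_closure_outside[OF permute(1), of X w2]
    theta.not_in_closure_outside[OF permute(3), of X w1] assms by (auto simp: Un_ac)

text \<open>Outer points on two arcs force the third to be the inner one, and the inner arc has no
  outer point besides its ends.\<close>

lemma no_three_outer_arcs:
  assumes "path_image c1 \<union> path_image c2 \<union> path_image c3 \<subseteq> X"
    and "w1 \<in> path_image c1 - {a, b}" "w2 \<in> path_image c2 - {a, b}" "w3 \<in> path_image c3 - {a, b}"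
    and "{w1, w2, w3} \<subseteq> closure (outside X)"
  shows False
  using third_arc_inside[of X w1 w2] not_in_closure_outside[of X w3] assms by auto

end

text \<open>The closed curve formed by q1, q2, q3, q4 passes through a, c, b, d in this order, so that
  the chords e and f interleave.\<close>
lemma no_crossing_outer_chords:
  fixes q1 q2 q3 q4 e f :: "real \<Rightarrow> complex"
  assumes arcs: "arc q1" "arc q2" "arc q3" "arc q4" "arc e" "arc f"
    and ends: "pathstart q1 = a" "pathfinish q1 = c" "pathstart q2 = c" "pathfinish q2 = b"
      "pathstart q3 = b" "pathfinish q3 = d" "pathstart q4 = d" "pathfinish q4 = a"
      "pathstart e = a" "pathfinish e = b" "pathstart f = c" "pathfinish f = d"
    and neq: "distinct [a, b, c, d]"
    and cyc: "path_image q1 \<inter> path_image q2 = {c}" "path_image q2 \<inter> path_image q3 = {b}"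
      "path_image q3 \<inter> path_image q4 = {d}" "path_image q4 \<inter> path_image q1 = {a}"
      "path_image q1 \<inter> path_image q3 = {}" "path_image q2 \<inter> path_image q4 = {}"
    and e: "path_image e \<inter> (path_image q1 \<union> path_image q2 \<union> path_image q3 \<union> path_image q4) = {a, b}"
    and f: "path_image f \<inter> (path_image q1 \<union> path_image q2 \<union> path_image q3 \<union> path_image q4) = {c, d}"
    and ef: "path_image e \<inter> path_image f = {}"
    and X: "path_image q1 \<union> path_image q2 \<union> path_image q3 \<union> path_image q4 \<union> path_image e
       \<union> path_image f \<subseteq> X"
    and out: "{a, b, c, d} \<subseteq> closure (outside X)"
  shows False
proof -
  \<comment> \<open>The cycle is cut in two ways: at \<open>a\<close> and \<open>b\<close> into
    \<open>p1\<close> and \<open>p2\<close>, at \<open>c\<close> and \<open>d\<close> into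
    \<open>r1\<close> and \<open>r2\<close>. Each cut together with its chord is a theta graph over
    the same closed curve.\<close>
  define p1 where "p1 = q1 +++ q2"
  define p2 where "p2 = reversepath q4 +++ reversepath q3"
  define r1 where "r1 = reversepath q1 +++ reversepath q4"
  define r2 where "r2 = q2 +++ q3"
  have im: "path_image p1 = path_image q1 \<union> path_image q2"
    "path_image p2 = path_image q4 \<union> path_image q3"
    "path_image r1 = path_image q1 \<union> path_image q4"
    "path_image r2 = path_image q2 \<union> path_image q3"
    using ends by (auto simp: p1_def p2_def r1_def r2_def path_image_join)
  have se: "pathstart p1 = a" "pathfinish p1 = b" "pathstart p2 = a" "pathfinish p2 = b"
    "pathstart r1 = c" "pathfinish r1 = d" "pathstart r2 = c" "pathfinish r2 = d"
    using ends by (auto simp: p1_def p2_def r1_def r2_def)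
  have ar: "arc p1" "arc p2" "arc r1" "arc r2"
    unfolding p1_def p2_def r1_def r2_def
    by (rule arc_join; use arcs ends cyc in \<open>auto simp: arc_reversepath\<close>)+
  have mem: "a \<in> path_image q1" "c \<in> path_image q1" "c \<in> path_image q2" "b \<in> path_image q2"
    "b \<in> path_image q3" "d \<in> path_image q3" "d \<in> path_image q4" "a \<in> path_image q4"
    using ends pathstart_in_path_image pathfinish_in_path_image by metis+
  interpret A: theta p1 p2 e a b
    by unfold_locales (use arcs ar se ends im cyc e mem in auto)
  interpret B: theta r1 r2 f c d
    by unfold_locales (use arcs ar se ends im cyc f mem in auto)
  let ?J = "path_image p1 \<union> path_image p2"
  have J: "path_image r1 \<union> path_image r2 = ?J" using im by auto
  have "path_image e \<inter> inside ?J \<noteq> {}"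
    using A.third_arc_inside[of X c d] im X out mem neq by auto
  \<comment> \<open>The chord \<open>e\<close> divides the interior of the cycle in two. The chord
    \<open>f\<close> also runs inside and avoids \<open>e\<close>, so it stays in one half.\<close>
  then obtain split:
    "inside (path_image p1 \<union> path_image e) \<inter> inside (path_image p2 \<union> path_image e) = {}"
    "inside (path_image p1 \<union> path_image e) \<union> inside (path_image p2 \<union> path_image e) \<union>
      (path_image e - {a, b}) = inside ?J"
    using split_inside_simple_closed_curve[of p1 a b p2 e] A.arcs A.ends A.disj A.neq arc_imp_simple_path
    by metis
  have "path_image f \<inter> inside (path_image r1 \<union> path_image r2) \<noteq> {}"
    using B.third_arc_inside[of X a b] im X out mem neq by auto
  then have fin: "path_image f - {c, d} \<subseteq> inside ?J"
    using B.interior_inside J by simp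
  let ?F = "path_image f - {c, d}"
  obtain x where x: "x \<in> ?F" using B.interior_nonempty by blast
  have cl: "closure ?F = path_image f"
  proof -
    have "path_image f - {c, d} = f ` {0<..<1}"
      using simple_path_endless[OF arc_imp_simple_path[OF arcs(6)]] ends by simp
    moreover have "f ` closure {0<..<1} \<subseteq> closure (f ` {0<..<1})"
      by (rule image_closure_subset)
        (use arcs(6) in \<open>auto simp: arc_def path_def closure_subset\<close>)
    moreover have "closure ?F \<subseteq> path_image f"
      using closed_path_image[OF arc_imp_path[OF arcs(6)]] by (intro closure_minimal) auto
    ultimately show ?thesis by (auto simp: path_image_def)
  qed
  \<comment> \<open>In the half bounded by \<open>p\<close> and \<open>e\<close>, the end
    \<open>v\<close> of \<open>f\<close> off \<open>p\<close> is a limit of points of the half but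
    is not on its frontier. So \<open>v\<close> is inside that half, which an outer point cannot
    be.\<close>
  have False if Y: "theta p q e a b" and v: "v \<in> {c, d}" "v \<notin> path_image p" and xi: "x \<in> inside (path_image p \<union> path_image e)"
    and sub: "path_image p \<subseteq> ?J" for p q v
  proof -
    interpret Y: theta p q e a b by fact
    interpret Z: theta p e q a b by (rule Y.permute)
    let ?K = "path_image p \<union> path_image e"
    have "?F \<inter> ?K = {}"
      using fin sub inside_no_overlap[of ?J] ef by blast
    then have "?F \<subseteq> inside ?K"
      using connected_subset_inside[OF B.interior_connected _ x xi] by blast
    then have "v \<in> closure (inside ?K)"
      using cl closure_mono v(1) f by blast
    moreover have "v \<notin> ?K" using v f ef by blast
    ultimately have "v \<in> inside ?K"
      using Z.jordan12(4) by (auto simp: closure_Un_frontier)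
    moreover have "?K \<subseteq> X" using sub im X by auto
    ultimately have "v \<notin> closure (outside X)"
      using inside_not_in_closure_outside[OF _ Z.jordan12(2)] by blast
    then show False using v(1) out by auto
  qed
  note key = this
  have "x \<in> inside (path_image p1 \<union> path_image e) \<or> x \<in> inside (path_image p2 \<union> path_image e)"
    using x fin split(2) ef by blast
  then show False
  proof
    assume "x \<in> inside (path_image p1 \<union> path_image e)"
    moreover have "d \<notin> path_image p1" using im cyc mem neq by auto
    ultimately show False using key[OF A.theta_axioms, of d] by blast
  next
    assume "x \<in> inside (path_image p2 \<union> path_image e)"
    moreover have "c \<notin> path_image p2" using im cyc mem neq by auto
    ultimately show False using key[OF A.permute(2), of c] by blast
  qed
qed

section \<open>Subgraphs excluded by an outer drawing\<close>

abbreviation walk :: "'a set set \<Rightarrow> 'a list \<Rightarrow> bool" where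
  "walk E \<equiv> successively (\<lambda>u v. {u, v} \<in> E)"

fun list_edges :: "'a list \<Rightarrow> 'a set set" where
  "list_edges (x # y # zs) = insert {x, y} (list_edges (y # zs))"
| "list_edges _ = {}"

lemma list_edges_subset: "e \<in> list_edges xs \<Longrightarrow> e \<subseteq> set xs"
  by (induction xs rule: list_edges.induct) auto

lemma list_edges_walk: "walk E xs \<Longrightarrow> list_edges xs \<subseteq> E"
  by (induction xs rule: list_edges.induct) auto

lemma Union_list_edges: "length xs \<ge> 2 \<Longrightarrow> \<Union> (list_edges xs) = set xs"
proof (induction xs rule: list_edges.induct)
  case (1 x y zs)
  then show ?case by (cases zs) auto
qed auto

lemma list_edges_two:
  assumes "distinct xs" "e \<in> list_edges xs"
  shows "\<exists>u v. u \<noteq> v \<and> e = {u, v}"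
  using assms by (induction xs rule: list_edges.induct) auto

lemma ends_not_list_edge:
  assumes "distinct (x # as @ [y])" "as \<noteq> []"
  shows "{x, y} \<notin> list_edges (x # as @ [y])"
proof
  assume "{x, y} \<in> list_edges (x # as @ [y])"
  moreover obtain z zs where "as = z # zs" using assms(2) by (cases as) auto
  ultimately have "{x, y} = {x, z} \<or> {x, y} \<subseteq> set (as @ [y])"
    using list_edges_subset by fastforce
  then show False using assms \<open>as = z # zs\<close> by (auto simp: doubleton_eq_iff)
qed

lemma list_edges_disjoint:
  assumes "distinct xs" "set xs \<inter> set ys \<subseteq> {v}"
  shows "list_edges xs \<inter> list_edges ys = {}"
proof (rule ccontr)
  assume "\<not> ?thesis"
  then obtain e where e: "e \<in> list_edges xs" "e \<in> list_edges ys" by blast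
  then show False
    using list_edges_two[OF assms(1) e(1)] list_edges_subset[OF e(1)] list_edges_subset[OF e(2)] assms(2)
    by blast
qed

text \<open>The common vertices leave only \<open>{x, y}\<close> as a common edge, and a nonempty
  \<open>as\<close> keeps \<open>x\<close> and \<open>y\<close> from being consecutive.\<close>

lemma list_edges_disjoint_parallel:
  assumes "distinct (x # as @ [y])" "as \<noteq> []" "set (x # as @ [y]) \<inter> set ys \<subseteq> {x, y}"
  shows "list_edges (x # as @ [y]) \<inter> list_edges ys = {}"
proof (rule ccontr)
  assume "\<not> ?thesis"
  then obtain e where e: "e \<in> list_edges (x # as @ [y])" "e \<in> list_edges ys" by blast
  then have "e = {x, y}"
    using list_edges_two[OF assms(1) e(1)] list_edges_subset[OF e(1)] list_edges_subset[OF e(2)] assms(3)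
    by blast
  then show False using ends_not_list_edge[OF assms(1,2)] e(1) by simp
qed

section \<open>Walks of the graph as arcs of the drawing\<close>

definition drawn :: "('a set \<Rightarrow> real \<Rightarrow> complex) \<Rightarrow> 'a list \<Rightarrow> complex set" where
  "drawn \<gamma> xs = (\<Union>e\<in>list_edges xs. path_image (\<gamma> e))"

locale outer_drawing =
  fixes V :: "'a set" and E :: "'a set set" and pos :: "'a \<Rightarrow> complex"
    and \<gamma> :: "'a set \<Rightarrow> real \<Rightarrow> complex"
  assumes drawing: "planar_drawing V E pos \<gamma>"
    and outer: "\<And>v. v \<in> V \<Longrightarrow>
      pos v \<in> closure (outside (pos ` V \<union> (\<Union>e\<in>E. path_image (\<gamma> e))))"
begin

lemma inj: "inj_on pos V"
  using drawing by (simp add: planar_drawing_def)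

lemma ends: "e \<in> E \<Longrightarrow> arc (\<gamma> e)" "e \<in> E \<Longrightarrow> pos ` e = {pathstart (\<gamma> e), pathfinish (\<gamma> e)}"
  using drawing by (auto simp: planar_drawing_def)

lemma ends_in_image: "e \<in> E \<Longrightarrow> pos ` e \<subseteq> path_image (\<gamma> e)"
  using ends(2) by auto

lemma edges_meet:
  "e \<in> E \<Longrightarrow> e' \<in> E \<Longrightarrow> e \<noteq> e' \<Longrightarrow> path_image (\<gamma> e) \<inter> path_image (\<gamma> e') \<subseteq> pos ` (e \<inter> e')"
  using drawing by (auto simp: planar_drawing_def)

lemma drawn_subset: "walk E xs \<Longrightarrow> drawn \<gamma> xs \<subseteq> (\<Union>e\<in>E. path_image (\<gamma> e))"
  unfolding drawn_def using list_edges_walk by blast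

lemma vertices_drawn:
  assumes "walk E xs" "length xs \<ge> 2"
  shows "pos ` set xs \<subseteq> drawn \<gamma> xs"
proof -
  have "pos ` e \<subseteq> path_image (\<gamma> e)" if "e \<in> list_edges xs" for e
    using that ends_in_image list_edges_walk[OF assms(1)] by blast
  then show ?thesis
    unfolding drawn_def Union_list_edges[OF assms(2), symmetric] by blast
qed

text \<open>A planar drawing controls intersections of different edges only, hence the assumption
  that the walks share no edge.\<close>

lemma drawn_meet_subset:
  assumes "walk E xs" "walk E ys" "list_edges xs \<inter> list_edges ys = {}"
  shows "drawn \<gamma> xs \<inter> drawn \<gamma> ys \<subseteq> pos ` (set xs \<inter> set ys)"
proof
  fix p assume "p \<in> drawn \<gamma> xs \<inter> drawn \<gamma> ys"
  then obtain e e' where e: "e \<in> list_edges xs" "e' \<in> list_edges ys"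
    and p: "p \<in> path_image (\<gamma> e)" "p \<in> path_image (\<gamma> e')" by (auto simp: drawn_def)
  have "e \<in> E" "e' \<in> E" "e \<noteq> e'"
    using e list_edges_walk assms by blast+
  then have "p \<in> pos ` (e \<inter> e')" using edges_meet p by blast
  then show "p \<in> pos ` (set xs \<inter> set ys)"
    using e list_edges_subset by blast
qed

lemma drawn_meet:
  assumes "walk E xs" "walk E ys" "length xs \<ge> 2" "length ys \<ge> 2"
    and "list_edges xs \<inter> list_edges ys = {}"
  shows "drawn \<gamma> xs \<inter> drawn \<gamma> ys = pos ` (set xs \<inter> set ys)"
  using drawn_meet_subset[OF assms(1,2,5)] vertices_drawn[OF assms(1,3)] vertices_drawn[OF assms(2,4)]
  by blast

text \<open>The drawing does not orient its edges, so the arc may have to be reversed.\<close>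

lemma edge_arc:
  assumes "{x, y} \<in> E" "x \<noteq> y" "x \<in> V" "y \<in> V"
  obtains g where "arc g" "pathstart g = pos x" "pathfinish g = pos y"
    "path_image g = path_image (\<gamma> {x, y})"
proof -
  let ?g = "\<gamma> {x, y}"
  have "pos x \<noteq> pos y" using inj assms by (auto dest: inj_onD)
  then have "pathstart ?g = pos x \<and> pathfinish ?g = pos y \<or> pathstart ?g = pos y \<and> pathfinish ?g = pos x"
    using ends(2)[OF assms(1)] by (auto simp: doubleton_eq_iff)
  then show thesis
    using that[of ?g] that[of "reversepath ?g"] ends(1)[OF assms(1)] by (auto simp: arc_reversepath)
qed

lemma walk_arc:
  assumes "distinct xs" "set xs \<subseteq> V" "walk E xs" "length xs \<ge> 2"
  shows "\<exists>g. arc g \<and> pathstart g = pos (hd xs) \<and> pathfinish g = pos (last xs) \<and>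
    path_image g = drawn \<gamma> xs"
  using assms
proof (induction xs rule: list_edges.induct)
  case (1 x y zs)
  obtain g where g: "arc g" "pathstart g = pos x" "pathfinish g = pos y"
    "path_image g = path_image (\<gamma> {x, y})"
    using edge_arc[of x y] 1 by auto
  show ?case
  proof (cases zs)
    case Nil
    then show ?thesis using g by (auto simp: drawn_def)
  next
    case (Cons z zs')
    then obtain h where h: "arc h" "pathstart h = pos y" "pathfinish h = pos (last (y # zs))"
      "path_image h = drawn \<gamma> (y # zs)"
      using 1 by auto
    have "path_image g = drawn \<gamma> [x, y]" using g by (simp add: drawn_def)
    moreover have "list_edges [x, y] \<inter> list_edges (y # zs) = {}"
      using list_edges_disjoint[of "[x, y]" "y # zs" y] 1 by auto
    ultimately have "path_image g \<inter> path_image h \<subseteq> {pos y}"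
      using drawn_meet_subset[of "[x, y]" "y # zs"] 1 h by auto
    then have "arc (g +++ h)" using arc_join g h by metis
    moreover have "path_image (g +++ h) = drawn \<gamma> (x # y # zs)"
      using g h by (simp add: path_image_join drawn_def)
    ultimately show ?thesis
      using g h by (intro exI[of _ "g +++ h"]) auto
  qed
qed auto

end

text \<open>A subdivided \<open>K_{2,3}\<close> with branch vertices \<open>x\<close> and
  \<open>y\<close>. The lists hold the inner vertices of its three paths, and none may be
  empty.\<close>

definition theta_subgraph :: "'a set \<Rightarrow> 'a set set \<Rightarrow> bool" where
  "theta_subgraph V E \<longleftrightarrow> (\<exists>x y as bs cs. distinct (x # y # as @ bs @ cs) \<and>
     set (x # y # as @ bs @ cs) \<subseteq> V \<and> as \<noteq> [] \<and> bs \<noteq> [] \<and> cs \<noteq> [] \<and>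
     walk E (x # as @ [y]) \<and> walk E (x # bs @ [y]) \<and> walk E (x # cs @ [y]))"

text \<open>The cycle visits \<open>a\<close>, \<open>c\<close>, \<open>b\<close>, \<open>d\<close>
  in this order, so this is a subdivided \<open>K_4\<close> with two opposite edges left whole.
  Single edges suffice as chords because the cycle will later contain all vertices.\<close>

definition crossed_cycle :: "'a set \<Rightarrow> 'a set set \<Rightarrow> bool" where
  "crossed_cycle V E \<longleftrightarrow> (\<exists>a b c d as bs cs ds. distinct (a # as @ c # bs @ b # cs @ d # ds) \<and>
     set (a # as @ c # bs @ b # cs @ d # ds) \<subseteq> V \<and>
     walk E (a # as @ c # bs @ b # cs @ d # ds @ [a]) \<and> {a, b} \<in> E \<and> {c, d} \<in> E)"

context outer_drawing
begin

lemma no_theta_subgraph: "\<not> theta_subgraph V E"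
proof
  assume "theta_subgraph V E"
  then obtain x y as bs cs where d: "distinct (x # y # as @ bs @ cs)"
    and V: "set (x # y # as @ bs @ cs) \<subseteq> V" and ne: "as \<noteq> []" "bs \<noteq> []" "cs \<noteq> []"
    and w: "walk E (x # as @ [y])" "walk E (x # bs @ [y])" "walk E (x # cs @ [y])"
    unfolding theta_subgraph_def by blast
  let ?X = "pos ` V \<union> (\<Union>e\<in>E. path_image (\<gamma> e))"
  obtain g1 where g1: "arc g1" "pathstart g1 = pos x" "pathfinish g1 = pos y"
    "path_image g1 = drawn \<gamma> (x # as @ [y])"
    using walk_arc[of "x # as @ [y]"] d V w by auto
  obtain g2 where g2: "arc g2" "pathstart g2 = pos x" "pathfinish g2 = pos y"
    "path_image g2 = drawn \<gamma> (x # bs @ [y])"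
    using walk_arc[of "x # bs @ [y]"] d V w by auto
  obtain g3 where g3: "arc g3" "pathstart g3 = pos x" "pathfinish g3 = pos y"
    "path_image g3 = drawn \<gamma> (x # cs @ [y])"
    using walk_arc[of "x # cs @ [y]"] d V w by auto
  have meet: "drawn \<gamma> (x # us @ [y]) \<inter> drawn \<gamma> (x # vs @ [y]) = {pos x, pos y}"
    if "distinct (x # y # us @ vs)" "walk E (x # us @ [y])" "walk E (x # vs @ [y])" "us \<noteq> []" for us vs
  proof -
    have "set (x # us @ [y]) \<inter> set (x # vs @ [y]) = {x, y}" using that(1) by auto
    moreover from this have "list_edges (x # us @ [y]) \<inter> list_edges (x # vs @ [y]) = {}"
      using that by (intro list_edges_disjoint_parallel) auto
    ultimately show ?thesis
      using drawn_meet[OF that(2,3)] by simp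
  qed
  interpret theta g1 g2 g3 "pos x" "pos y"
    by unfold_locales
      (use g1 g2 g3 meet[of as bs] meet[of as cs] meet[of bs cs] d w ne in \<open>auto simp: Int_Un_distrib\<close>)
  \<comment> \<open>The first inner vertex of a path is the outer point that its arc has to
    carry.\<close>
  have v: "pos (hd us) \<in> drawn \<gamma> (x # us @ [y]) - {pos x, pos y}"
    if "us \<noteq> []" "distinct (x # y # us)" "set (x # y # us) \<subseteq> V" "walk E (x # us @ [y])" for us
    using vertices_drawn[OF that(4)] that(1-3) inj by (cases us) (auto dest: inj_onD)
  show False
  proof (rule no_three_outer_arcs)
    show "path_image g1 \<union> path_image g2 \<union> path_image g3 \<subseteq> ?X"
      using g1 g2 g3 w drawn_subset by blast
    show "pos (hd as) \<in> path_image g1 - {pos x, pos y}" using v[of as] g1 d V w ne by auto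
    show "pos (hd bs) \<in> path_image g2 - {pos x, pos y}" using v[of bs] g2 d V w ne by auto
    show "pos (hd cs) \<in> path_image g3 - {pos x, pos y}" using v[of cs] g3 d V w ne by auto
    have "{hd as, hd bs, hd cs} \<subseteq> V" using V ne by auto
    then show "{pos (hd as), pos (hd bs), pos (hd cs)} \<subseteq> closure (outside ?X)"
      using outer by auto
  qed
qed

lemma no_crossed_cycle: "\<not> crossed_cycle V E"
proof
  assume "crossed_cycle V E"
  then obtain a b c d as bs cs ds where dis: "distinct (a # as @ c # bs @ b # cs @ d # ds)"
    and V: "set (a # as @ c # bs @ b # cs @ d # ds) \<subseteq> V"
    and w: "walk E (a # as @ c # bs @ b # cs @ d # ds @ [a])" and ab: "{a, b} \<in> E" and cd: "{c, d} \<in> E"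
    unfolding crossed_cycle_def by blast
  let ?X = "pos ` V \<union> (\<Union>e\<in>E. path_image (\<gamma> e))"
  define p1 p2 p3 p4 where "p1 = a # as @ [c]" and "p2 = c # bs @ [b]" and "p3 = b # cs @ [d]" and "p4 = d # ds @ [a]"
  note p = p1_def p2_def p3_def p4_def
  have "walk E p1" "walk E p2" "walk E p3" "walk E p4"
  proof -
    have "walk E (p1 @ bs @ b # cs @ p4)" using w by (simp add: p)
    then show "walk E p1" by (simp only: successively_append_iff)
    have "walk E ((a # as) @ p2 @ cs @ p4)" using w by (simp add: p)
    then show "walk E p2" by (simp only: successively_append_iff)
    have "walk E ((a # as @ c # bs) @ p3 @ ds @ [a])" using w by (simp add: p)
    then show "walk E p3" by (simp only: successively_append_iff)
    have "walk E ((a # as @ c # bs @ b # cs) @ p4)" using w by (simp add: p)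
    then show "walk E p4" by (simp only: successively_append_iff)
  qed
  then have W: "walk E p1" "walk E p2" "walk E p3" "walk E p4" "walk E [a, b]" "walk E [c, d]"
    using ab cd by simp_all
  have D: "distinct p1" "distinct p2" "distinct p3" "distinct p4" "distinct [a, b]" "distinct [c, d]"
    using dis by (auto simp: p)
  have L: "length p1 \<ge> 2" "length p2 \<ge> 2" "length p3 \<ge> 2" "length p4 \<ge> 2"
    "length [a, b] \<ge> 2" "length [c, d] \<ge> 2"
    by (auto simp: p)
  have S: "set p1 \<subseteq> V" "set p2 \<subseteq> V" "set p3 \<subseteq> V" "set p4 \<subseteq> V" "set [a, b] \<subseteq> V" "set [c, d] \<subseteq> V"
    using V by (auto simp: p)
  obtain q1 where q1: "arc q1" "pathstart q1 = pos a" "pathfinish q1 = pos c" "path_image q1 = drawn \<gamma> p1"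
    using walk_arc[OF D(1) S(1) W(1) L(1)] by (auto simp: p)
  obtain q2 where q2: "arc q2" "pathstart q2 = pos c" "pathfinish q2 = pos b" "path_image q2 = drawn \<gamma> p2"
    using walk_arc[OF D(2) S(2) W(2) L(2)] by (auto simp: p)
  obtain q3 where q3: "arc q3" "pathstart q3 = pos b" "pathfinish q3 = pos d" "path_image q3 = drawn \<gamma> p3"
    using walk_arc[OF D(3) S(3) W(3) L(3)] by (auto simp: p)
  obtain q4 where q4: "arc q4" "pathstart q4 = pos d" "pathfinish q4 = pos a" "path_image q4 = drawn \<gamma> p4"
    using walk_arc[OF D(4) S(4) W(4) L(4)] by (auto simp: p)
  obtain e where e: "arc e" "pathstart e = pos a" "pathfinish e = pos b" "path_image e = drawn \<gamma> [a, b]"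
    using walk_arc[OF D(5) S(5) W(5) L(5)] by auto
  obtain f where f: "arc f" "pathstart f = pos c" "pathfinish f = pos d" "path_image f = drawn \<gamma> [c, d]"
    using walk_arc[OF D(6) S(6) W(6) L(6)] by auto
  \<comment> \<open>Any two of the six lists have at most one common vertex, so they share no edge
    and \<open>drawn_meet\<close> applies.\<close>
  have meet: "drawn \<gamma> us \<inter> drawn \<gamma> vs = pos ` M"
    if "distinct us" "walk E us" "walk E vs" "length us \<ge> 2" "length vs \<ge> 2" "set us \<inter> set vs = M" "M \<subseteq> {v}"
    for us vs M v
    using drawn_meet[OF that(2-5)] list_edges_disjoint[OF that(1), of vs v] that(6,7) by auto
  have i: "set p1 \<inter> set p2 = {c}" "set p2 \<inter> set p3 = {b}" "set p3 \<inter> set p4 = {d}" "set p4 \<inter> set p1 = {a}"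
    "set p1 \<inter> set p3 = {}" "set p2 \<inter> set p4 = {}"
    "set [a, b] \<inter> set p1 = {a}" "set [a, b] \<inter> set p2 = {b}" "set [a, b] \<inter> set p3 = {b}" "set [a, b] \<inter> set p4 = {a}"
    "set [c, d] \<inter> set p1 = {c}" "set [c, d] \<inter> set p2 = {c}" "set [c, d] \<inter> set p3 = {d}" "set [c, d] \<inter> set p4 = {d}"
    "set [a, b] \<inter> set [c, d] = {}"
    using dis by (auto simp: p)
  note m = meet[OF D(1) W(1,2) L(1,2) i(1) subset_refl] meet[OF D(2) W(2,3) L(2,3) i(2) subset_refl]
    meet[OF D(3) W(3,4) L(3,4) i(3) subset_refl] meet[OF D(4) W(4,1) L(4,1) i(4) subset_refl]
    meet[OF D(1) W(1,3) L(1,3) i(5) empty_subsetI] meet[OF D(2) W(2,4) L(2,4) i(6) empty_subsetI]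
  note me = meet[OF D(5) W(5,1) L(5,1) i(7) subset_refl] meet[OF D(5) W(5,2) L(5,2) i(8) subset_refl]
    meet[OF D(5) W(5,3) L(5,3) i(9) subset_refl] meet[OF D(5) W(5,4) L(5,4) i(10) subset_refl]
  note mf = meet[OF D(6) W(6,1) L(6,1) i(11) subset_refl] meet[OF D(6) W(6,2) L(6,2) i(12) subset_refl]
    meet[OF D(6) W(6,3) L(6,3) i(13) subset_refl] meet[OF D(6) W(6,4) L(6,4) i(14) subset_refl]
  note ef = meet[OF D(5) W(5,6) L(5,6) i(15) empty_subsetI]
  show False
  proof (rule no_crossing_outer_chords[OF q1(1) q2(1) q3(1) q4(1) e(1) f(1) q1(2,3) q2(2,3) q3(2,3) q4(2,3) e(2,3) f(2,3)])
    have "distinct [a, b, c, d]" "set [a, b, c, d] \<subseteq> V" using dis V by auto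
    then have "distinct (map pos [a, b, c, d])"
      using inj inj_on_subset by (metis distinct_map)
    then show "distinct [pos a, pos b, pos c, pos d]" by simp
    show "path_image e \<inter> (path_image q1 \<union> path_image q2 \<union> path_image q3 \<union> path_image q4) = {pos a, pos b}"
      unfolding Int_Un_distrib e(4) q1(4) q2(4) q3(4) q4(4) me by auto
    show "path_image f \<inter> (path_image q1 \<union> path_image q2 \<union> path_image q3 \<union> path_image q4) = {pos c, pos d}"
      unfolding Int_Un_distrib f(4) q1(4) q2(4) q3(4) q4(4) mf by auto
    show "path_image q1 \<union> path_image q2 \<union> path_image q3 \<union> path_image q4 \<union> path_image e \<union> path_image f \<subseteq> ?X"
      unfolding e(4) f(4) q1(4) q2(4) q3(4) q4(4) using W[THEN drawn_subset] by blast
    show "{pos a, pos b, pos c, pos d} \<subseteq> closure (outside ?X)"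
      using outer V by auto
  qed (use m ef q1 q2 q3 q4 e f in auto)
qed

end

lemma outerplanar_imp_no_theta_crossing:
  assumes "outerplanar V E"
  shows "\<not> theta_subgraph V E" "\<not> crossed_cycle V E"
proof -
  obtain pos \<gamma> where "outer_drawing V E pos \<gamma>"
    using assms unfolding outerplanar_def outer_drawing_def by blast
  then show "\<not> theta_subgraph V E" "\<not> crossed_cycle V E"
    by (rule outer_drawing.no_theta_subgraph, rule outer_drawing.no_crossed_cycle)
qed

section \<open>Drawings on a parabola\<close>

text \<open>Positions on a line, to be read as points on a circle cut open. Only their order matters
  and gaps are allowed, so an order can be changed by shifting some of the values.\<close>

definition noncrossing :: "('a \<Rightarrow> nat) \<Rightarrow> 'a set \<Rightarrow> 'a set set \<Rightarrow> bool" where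
  "noncrossing f V E \<longleftrightarrow> inj_on f V \<and>
     \<not> (\<exists>a\<in>V. \<exists>b\<in>V. \<exists>c\<in>V. \<exists>d\<in>V. f a < f b \<and> f b < f c \<and> f c < f d \<and> {a, c} \<in> E \<and> {b, d} \<in> E)"

definition parabola :: "real \<Rightarrow> complex" where
  "parabola t = Complex t (t\<^sup>2)"

text \<open>The chord is the graph of \<open>(s + t) * x - s * t\<close>, and subtracting the square
  of \<open>x\<close> leaves \<open>(x - s) * (t - x)\<close>. In this form chords are compared by
  their height above the parabola.\<close>

lemma parabola_chord:
  assumes "s < t"
  shows "p \<in> closed_segment (parabola s) (parabola t) \<longleftrightarrow>
    s \<le> Re p \<and> Re p \<le> t \<and> Im p = (Re p)\<^sup>2 + (Re p - s) * (t - Re p)"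
proof
  assume "p \<in> closed_segment (parabola s) (parabola t)"
  then obtain u where u: "0 \<le> u" "u \<le> 1" "p = (1 - u) *\<^sub>R parabola s + u *\<^sub>R parabola t"
    by (auto simp: in_segment)
  then have re: "Re p = s + u * (t - s)" and im: "Im p = (1 - u) * s\<^sup>2 + u * t\<^sup>2"
    unfolding u(3) by (simp_all add: parabola_def algebra_simps)
  have "0 \<le> u * (t - s)" "u * (t - s) \<le> 1 * (t - s)"
    using u assms by (auto intro: mult_right_mono)
  then show "s \<le> Re p \<and> Re p \<le> t \<and> Im p = (Re p)\<^sup>2 + (Re p - s) * (t - Re p)"
    unfolding re im by (auto simp: algebra_simps power2_eq_square)
next
  assume p: "s \<le> Re p \<and> Re p \<le> t \<and> Im p = (Re p)\<^sup>2 + (Re p - s) * (t - Re p)"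
  define u where "u = (Re p - s) / (t - s)"
  have u: "u * (t - s) = Re p - s" using assms by (simp add: u_def)
  have "0 \<le> u" "u \<le> 1" using p assms by (auto simp: u_def)
  moreover have "Re p = (1 - u) * s + u * t" using u by (simp add: algebra_simps)
  moreover have "Im p = (1 - u) * s\<^sup>2 + u * t\<^sup>2"
  proof -
    have "Im p = s\<^sup>2 + (s + t) * (Re p - s)" using p by (simp add: algebra_simps power2_eq_square)
    also have "\<dots> = s\<^sup>2 + (s + t) * (u * (t - s))" using u by simp
    finally show ?thesis by (simp add: algebra_simps power2_eq_square)
  qed
  ultimately show "p \<in> closed_segment (parabola s) (parabola t)"
    by (auto simp: in_segment parabola_def complex_eq_iff intro!: exI[of _ u])
qed

text \<open>At abscissa \<open>x\<close> the outer chord is higher than the inner one by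
  \<open>(c - a) * (b - x) + (x - c) * (b - d)\<close>, where both terms are nonnegative. At a
  common point both vanish, which leaves only a shared end.\<close>

lemma parabola_chord_nested:
  assumes "a \<le> c" "c < d" "d \<le> b" "\<not> (a = c \<and> b = d)"
    and "p \<in> closed_segment (parabola a) (parabola b)" "p \<in> closed_segment (parabola c) (parabola d)"
  shows "\<exists>t \<in> {a, b} \<inter> {c, d}. p = parabola t"
proof -
  let ?x = "Re p"
  have ab: "a < b" using assms by simp
  have x: "c \<le> ?x" "?x \<le> d" and im: "Im p = ?x\<^sup>2 + (?x - a) * (b - ?x)" "Im p = ?x\<^sup>2 + (?x - c) * (d - ?x)"
    using assms(5,6) parabola_chord[OF ab] parabola_chord[OF assms(2)] by auto
  have "(?x - a) * (b - ?x) = (?x - c) * (d - ?x)" using im by simp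
  then have eq: "(c - a) * (b - ?x) + (?x - c) * (b - d) = 0" by (simp add: algebra_simps)
  have "0 \<le> (c - a) * (b - ?x)" "0 \<le> (?x - c) * (b - d)"
    using assms x by auto
  then have z: "(c - a) * (b - ?x) = 0" "(?x - c) * (b - d) = 0" using eq by linarith+
  then consider "c = a" "?x = c" | "?x = b" "d = b" | "c = a" "b = d"
    using assms x by auto
  then show ?thesis
  proof cases
    case 1
    then have "p = parabola a" using im by (simp add: parabola_def complex_eq_iff)
    then show ?thesis using 1 by auto
  next
    case 2
    then have "p = parabola b" using im by (simp add: parabola_def complex_eq_iff)
    then show ?thesis using 2 by auto
  qed (use assms in auto)
qed

lemma parabola_chord_disjoint:
  assumes "a < b" "b \<le> c" "c < d"
    and "p \<in> closed_segment (parabola a) (parabola b)" "p \<in> closed_segment (parabola c) (parabola d)"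
  shows "\<exists>t \<in> {a, b} \<inter> {c, d}. p = parabola t"
proof -
  have "Re p = b" "b = c" "Im p = (Re p)\<^sup>2 + (Re p - a) * (b - Re p)"
    using assms(2,4,5) parabola_chord[OF assms(1)] parabola_chord[OF assms(3)] by auto
  then show ?thesis by (auto simp: parabola_def complex_eq_iff)
qed

lemma parabola_chords_meet:
  assumes "a < b" "c < d" "\<not> (a < c \<and> c < b \<and> b < d)" "\<not> (c < a \<and> a < d \<and> d < b)"
    and "\<not> (a = c \<and> b = d)"
    and "p \<in> closed_segment (parabola a) (parabola b)" "p \<in> closed_segment (parabola c) (parabola d)"
  shows "\<exists>t \<in> {a, b} \<inter> {c, d}. p = parabola t"
proof -
  consider "a \<le> c" "d \<le> b" | "c \<le> a" "b \<le> d" | "b \<le> c" | "d \<le> a"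
    using assms(1-4) by linarith
  then show ?thesis
  proof cases
    case 1
    then show ?thesis using parabola_chord_nested[of a c d b p] assms by auto
  next
    case 2
    then show ?thesis using parabola_chord_nested[of c a b d p] assms by blast
  next
    case 3
    then show ?thesis using parabola_chord_disjoint[of a b c d p] assms by auto
  next
    case 4
    then show ?thesis using parabola_chord_disjoint[of c d a b p] assms by blast
  qed
qed

lemma convex_epigraph_square: "convex {p. (Re p)\<^sup>2 \<le> Im p}"
proof (rule convexI)
  fix x y :: complex and u v :: real
  assume xy: "x \<in> {p. (Re p)\<^sup>2 \<le> Im p}" "y \<in> {p. (Re p)\<^sup>2 \<le> Im p}" and uv: "0 \<le> u" "0 \<le> v" "u + v = 1"
  have "u * (Re x)\<^sup>2 + v * (Re y)\<^sup>2 - (u * Re x + v * Re y)\<^sup>2 = u * v * (Re x - Re y)\<^sup>2"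
  proof -
    have v: "v = 1 - u" using uv by simp
    show ?thesis unfolding v by (simp add: power2_eq_square algebra_simps)
  qed
  moreover have "0 \<le> u * v * (Re x - Re y)\<^sup>2" using uv by simp
  moreover have "u * (Re x)\<^sup>2 \<le> u * Im x" "v * (Re y)\<^sup>2 \<le> v * Im y"
    using xy uv by (auto intro: mult_left_mono)
  ultimately show "u *\<^sub>R x + v *\<^sub>R y \<in> {p. (Re p)\<^sup>2 \<le> Im p}" by simp
qed

text \<open>The region above the parabola is convex and contains \<open>X\<close>, so its complement
  lies in \<open>outside X\<close>. Points just below the parabola belong to this
  complement.\<close>

lemma parabola_in_closure_outside:
  assumes "X \<subseteq> {p. (Re p)\<^sup>2 \<le> Im p}"
  shows "parabola t \<in> closure (outside X)"
proof -
  have sub: "- {p. (Re p)\<^sup>2 \<le> Im p} \<subseteq> outside X"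
    using outside_mono[OF assms] outside_convex[OF convex_epigraph_square] by simp
  have "parabola t \<in> closure (- {p. (Re p)\<^sup>2 \<le> Im p})"
    unfolding closure_approachable
  proof (intro allI impI)
    fix e :: real assume e: "e > 0"
    have "dist (Complex t (t\<^sup>2 - e / 2)) (parabola t) = e / 2"
      using e by (simp add: parabola_def dist_complex_def cmod_def)
    then show "\<exists>y\<in>- {p. (Re p)\<^sup>2 \<le> Im p}. dist y (parabola t) < e"
      using e by (intro bexI[of _ "Complex t (t\<^sup>2 - e / 2)"]) auto
  qed
  then show ?thesis using closure_mono[OF sub] by blast
qed

lemma noncrossing_imp_outerplanar:
  assumes G: "simple_graph V E" and nc: "noncrossing f V E"
  shows "outerplanar V E"
proof -
  define pos where "pos v = parabola (real (f v))" for v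
  have inj: "inj_on f V" using nc by (simp add: noncrossing_def)
  have "\<exists>u v. u \<in> V \<and> v \<in> V \<and> f u < f v \<and> e = {u, v}" if "e \<in> E" for e
  proof -
    have "\<exists>u v. u \<in> V \<and> v \<in> V \<and> u \<noteq> v \<and> e = {u, v}"
      using G that by (simp add: simple_graph_def)
    then obtain u v where uv: "u \<in> V" "v \<in> V" "u \<noteq> v" "e = {u, v}"
      by (elim exE conjE)
    then have "f u \<noteq> f v" using inj_onD[OF inj] by metis
    then show ?thesis
    proof (cases "f u < f v")
      case True
      then show ?thesis using uv by blast
    next
      case False
      then show ?thesis using uv \<open>f u \<noteq> f v\<close>
        by (intro exI[of _ v] exI[of _ u]) auto
    qed
  qed
  then have "\<forall>e\<in>E. \<exists>p. fst p \<in> V \<and> snd p \<in> V \<and> f (fst p) < f (snd p) \<and> e = {fst p, snd p}"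
    by (metis fst_conv snd_conv)
  then obtain p where p: "\<forall>e\<in>E. fst (p e) \<in> V \<and> snd (p e) \<in> V \<and> f (fst (p e)) < f (snd (p e)) \<and>
      e = {fst (p e), snd (p e)}"
    by (rule bchoice[THEN exE])
  define l r where "l e = fst (p e)" and "r e = snd (p e)" for e
  have lr: "l e \<in> V \<and> r e \<in> V \<and> f (l e) < f (r e)" and lr': "{l e, r e} = e" if "e \<in> E" for e
    using p that unfolding l_def r_def by blast+
  define \<gamma> where "\<gamma> e = linepath (pos (l e)) (pos (r e))" for e
  have im: "path_image (\<gamma> e) = closed_segment (parabola (f (l e))) (parabola (f (r e)))" for e
    by (simp add: \<gamma>_def pos_def)
  have pos_eq: "pos u = pos v \<longleftrightarrow> f u = f v" for u v
    by (auto simp: pos_def parabola_def)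
  have "planar_drawing V E pos \<gamma>"
    unfolding planar_drawing_def
  proof (intro conjI ballI impI)
    show "inj_on pos V" using inj pos_eq by (auto simp: inj_on_def)
  next
    fix e assume e: "e \<in> E"
    show "arc (\<gamma> e)" using lr[OF e] pos_eq unfolding \<gamma>_def by (intro arc_linepath) auto
    show "pos ` e = {pathstart (\<gamma> e), pathfinish (\<gamma> e)}"
      using lr'[OF e] by (metis \<gamma>_def image_empty image_insert pathfinish_linepath pathstart_linepath)
  next
    fix e w assume e: "e \<in> E" and w: "w \<in> V" "pos w \<in> path_image (\<gamma> e)"
    \<comment> \<open>A vertex has height zero above the parabola, so one factor of the height of
      the chord vanishes there.\<close>
    have "(real (f w) - f (l e)) * (f (r e) - real (f w)) = 0"
      using w(2) lr[OF e] parabola_chord[of "f (l e)" "f (r e)" "pos w"] unfolding im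
      by (auto simp: pos_def parabola_def)
    then have "f w = f (l e) \<or> f w = f (r e)" by auto
    then have "w = l e \<or> w = r e" using w lr[OF e] inj by (auto dest: inj_onD)
    then show "w \<in> e" using lr'[OF e] by blast
  next
    fix e e' assume e: "e \<in> E" "e' \<in> E" "e \<noteq> e'"
    show "path_image (\<gamma> e) \<inter> path_image (\<gamma> e') \<subseteq> pos ` (e \<inter> e')"
    proof
      fix p assume p: "p \<in> path_image (\<gamma> e) \<inter> path_image (\<gamma> e')"
      have 1: "\<not> (f (l e) < f (l e') \<and> f (l e') < f (r e) \<and> f (r e) < f (r e'))"
        using nc lr[OF e(1)] lr[OF e(2)] lr'[OF e(1)] lr'[OF e(2)] e(1,2) unfolding noncrossing_def by metis
      have 2: "\<not> (f (l e') < f (l e) \<and> f (l e) < f (r e') \<and> f (r e') < f (r e))"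
        using nc lr[OF e(1)] lr[OF e(2)] lr'[OF e(1)] lr'[OF e(2)] e(1,2) unfolding noncrossing_def by metis
      have 3: "\<not> (f (l e) = f (l e') \<and> f (r e) = f (r e'))"
        using lr[OF e(1)] lr[OF e(2)] lr'[OF e(1)] lr'[OF e(2)] e(3) inj by (metis inj_onD)
      obtain t where t: "t \<in> {real (f (l e)), real (f (r e))}" "t \<in> {real (f (l e')), real (f (r e'))}" "p = parabola t"
        using parabola_chords_meet[of "f (l e)" "f (r e)" "f (l e')" "f (r e')" p]
          1 2 3 p lr[OF e(1)] lr[OF e(2)] unfolding im by auto
      obtain v where v: "v \<in> {l e, r e}" "t = f v" using t(1) by blast
      moreover obtain v' where v': "v' \<in> {l e', r e'}" "t = f v'" using t(2) by blast
      moreover have "f v = f v'" using v(2) v'(2) by simp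
      ultimately have "v = v'" using lr[OF e(1)] lr[OF e(2)] inj by (auto dest: inj_onD)
      then show "p \<in> pos ` (e \<inter> e')"
        using v v' t(3) lr'[OF e(1)] lr'[OF e(2)] unfolding pos_def by blast
    qed
  qed
  moreover have "pos ` V \<union> (\<Union>e\<in>E. path_image (\<gamma> e)) \<subseteq> {p. (Re p)\<^sup>2 \<le> Im p}"
  proof -
    have "path_image (\<gamma> e) \<subseteq> {p. (Re p)\<^sup>2 \<le> Im p}" for e
      unfolding im
      by (intro closed_segment_subset convex_epigraph_square) (auto simp: parabola_def)
    then show ?thesis by (auto simp: pos_def parabola_def)
  qed
  ultimately show ?thesis
    using G parabola_in_closure_outside unfolding outerplanar_def pos_def by blast
qed

section \<open>Noncrossing orders\<close>

lemma noncrossingD: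
  assumes "noncrossing f V E" "a \<in> V" "b \<in> V" "c \<in> V" "d \<in> V"
    and "f a < f b" "f b < f c" "f c < f d" "{a, c} \<in> E" "{b, d} \<in> E"
  shows False
  using assms unfolding noncrossing_def by blast

text \<open>Crossing depends on the cyclic order alone, so the values before that of
  \<open>w\<close> may be moved behind all others. This brings a cut vertex to the front, as gluing
  requires.\<close>

lemma noncrossing_rotate:
  assumes "finite V" "w \<in> V" and nc: "noncrossing f V E"
  shows "\<exists>f'. noncrossing f' V E \<and> (\<forall>v\<in>V. f' w \<le> f' v)"
proof -
  define M where "M = Suc (Max (f ` V))"
  define f' where "f' v = (if f v < f w then f v + M else f v)" for v
  have M: "f v < M" if "v \<in> V" for v using that assms(1) by (simp add: M_def less_Suc_eq_le)
  have inj: "inj_on f V" using nc by (simp add: noncrossing_def)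
  have "f u = f v" if "u \<in> V" "v \<in> V" "f' u = f' v" for u v
    using M[OF that(1)] M[OF that(2)] that(3) unfolding f'_def by (simp split: if_splits)
  then have "inj_on f' V" using inj_onD[OF inj] by (metis inj_onI)
  moreover have False if V: "a \<in> V" "b \<in> V" "c \<in> V" "d \<in> V"
    and lt: "f' a < f' b" "f' b < f' c" "f' c < f' d" and E: "{a, c} \<in> E" "{b, d} \<in> E" for a b c d
  proof -
    have E': "{c, a} \<in> E" "{d, b} \<in> E" using E by (simp_all add: insert_commute)
    note less = M[OF V(1)] M[OF V(2)] M[OF V(3)] M[OF V(4)]
    \<comment> \<open>In the old order the four vertices appear up to a cyclic shift, so the same
      two edges cross there.\<close>
    have "f a < f b \<and> f b < f c \<and> f c < f d \<or> f d < f a \<and> f a < f b \<and> f b < f c \<or>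
      f c < f d \<and> f d < f a \<and> f a < f b \<or> f b < f c \<and> f c < f d \<and> f d < f a"
      using lt less unfolding f'_def by (smt (verit) add_less_cancel_right not_less_iff_gr_or_eq trans_less_add2 less_trans)
    then show False
      using noncrossingD[OF nc, of a b c d] noncrossingD[OF nc, of d a b c]
        noncrossingD[OF nc, of c d a b] noncrossingD[OF nc, of b c d a] V E E' by blast
  qed
  ultimately have "noncrossing f' V E" unfolding noncrossing_def by blast
  moreover have "\<forall>v\<in>V. f' w \<le> f' v" using M[OF assms(2)] by (auto simp: f'_def)
  ultimately show ?thesis by blast
qed

text \<open>By \<open>min1\<close> and \<open>min2\<close> a common vertex is first in both orders,
  and by injectivity there is at most one. The rest of \<open>V2\<close> is placed behind all of
  \<open>V1\<close>.\<close>

lemma noncrossing_glue: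
  assumes "finite V1" "finite V2"
    and nc: "noncrossing f1 V1 {e \<in> E. e \<subseteq> V1}" "noncrossing f2 V2 {e \<in> E. e \<subseteq> V2}"
    and min1: "\<And>u v. u \<in> V1 \<Longrightarrow> u \<in> V2 \<Longrightarrow> v \<in> V1 \<Longrightarrow> f1 u \<le> f1 v"
    and min2: "\<And>u v. u \<in> V1 \<Longrightarrow> u \<in> V2 \<Longrightarrow> v \<in> V2 \<Longrightarrow> f2 u \<le> f2 v"
    and E: "\<And>e. e \<in> E \<Longrightarrow> e \<subseteq> V1 \<or> e \<subseteq> V2"
  shows "\<exists>f. noncrossing f (V1 \<union> V2) E"
proof -
  define M where "M = Suc (Max (f1 ` V1))"
  define f where "f v = (if v \<in> V1 then f1 v else M + f2 v)" for v
  have M: "f1 v < M" if "v \<in> V1" for v using that assms(1) by (simp add: M_def less_Suc_eq_le)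
  have inj1: "inj_on f1 V1" and inj2: "inj_on f2 V2" using nc by (auto simp: noncrossing_def)
  have "u = v" if "u \<in> V1 \<union> V2" "v \<in> V1 \<union> V2" "f u = f v" for u v
    using that M[of u] M[of v] inj_onD[OF inj1, of u v] inj_onD[OF inj2, of u v]
    by (auto simp: f_def split: if_splits)
  then have inj: "inj_on f (V1 \<union> V2)" by (auto simp: inj_on_def)
  have less1: "f1 u < f1 v" if "u \<in> V1" "v \<in> V1" "f u < f v" for u v
    using that by (simp add: f_def)
  have less2: "f2 u < f2 v" if "u \<in> V2" "v \<in> V2" "f u < f v" for u v
  proof -
    have "f2 u \<noteq> f2 v" using that inj_onD[OF inj2, of u v] by auto
    moreover have "f2 u \<le> f2 v"
    proof (cases "u \<in> V1")
      case True then show ?thesis using min2 that by blast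
    next
      case False then show ?thesis using that M[of v] by (auto simp: f_def split: if_splits)
    qed
    ultimately show ?thesis by simp
  qed
  have down: "u \<in> V1" if "v \<in> V1" "f u < f v" for u v
    using that M[of v] by (auto simp: f_def split: if_splits)
  have False if V: "a \<in> V1 \<union> V2" "b \<in> V1 \<union> V2" "c \<in> V1 \<union> V2" "d \<in> V1 \<union> V2"
    and lt: "f a < f b" "f b < f c" "f c < f d" and ed: "{a, c} \<in> E" "{b, d} \<in> E" for a b c d
  proof -
    \<comment> \<open>In the mixed cases an end of the \<open>V2\<close> edge precedes a vertex of
      \<open>V1\<close> and so is in \<open>V1\<close> itself. It is then common and must come
      first, yet another vertex of \<open>V1\<close> precedes it.\<close>
    consider "{a, c} \<subseteq> V1" "{b, d} \<subseteq> V1" | "{a, c} \<subseteq> V2" "{b, d} \<subseteq> V2"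
      | "{a, c} \<subseteq> V1" "{b, d} \<subseteq> V2" | "{a, c} \<subseteq> V2" "{b, d} \<subseteq> V1"
      using E[OF ed(1)] E[OF ed(2)] by blast
    then show False
    proof cases
      case 1
      then show False using noncrossingD[OF nc(1), of a b c d] less1 lt ed by simp
    next
      case 2
      then show False using noncrossingD[OF nc(2), of a b c d] less2 lt ed by simp
    next
      case 3
      then have "b \<in> V1" using down lt by blast
      then show False using min1[of b a] less1[of a b] 3 lt by simp
    next
      case 4
      then have "c \<in> V1" using down lt by blast
      then show False using min1[of c b] less1[of b c] 4 lt by simp
    qed
  qed
  then have "noncrossing f (V1 \<union> V2) E" using inj unfolding noncrossing_def by blast
  then show ?thesis by blast
qed

section \<open>Closed walks, separations and ears\<close>

lemma walk_rev: "walk E (rev xs) \<longleftrightarrow> walk E xs"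
  by (simp add: insert_commute)

lemma walk_join: "walk E (xs @ [y]) \<Longrightarrow> walk E (y # ys) \<Longrightarrow> walk E (xs @ y # ys)"
  by (auto simp: successively_append_iff)

lemma walk_append: "walk E (xs @ ys) \<Longrightarrow> walk E xs \<and> walk E ys"
  by (simp add: successively_append_iff)

text \<open>The list does not repeat its first vertex. Length two is allowed: an edge walked back
  and forth starts the search for a longest cycle.\<close>

definition closed_walk :: "'a set set \<Rightarrow> 'a list \<Rightarrow> bool" where
  "closed_walk E xs \<longleftrightarrow> xs \<noteq> [] \<and> walk E (xs @ [hd xs])"

lemma closed_walk_rotate: "closed_walk E (xs @ ys) \<Longrightarrow> closed_walk E (ys @ xs)"
proof (cases xs; cases ys)
  fix a as b bs
  assume w: "closed_walk E (xs @ ys)" and xs: "xs = a # as" and ys: "ys = b # bs"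
  have "walk E ((a # as @ [b]) @ bs @ [a])" "walk E ((a # as) @ (b # bs @ [a]))"
    using w by (simp_all add: closed_walk_def xs ys)
  then have "walk E (a # as @ [b])" "walk E ((b # bs) @ [a])"
    using walk_append[of E "a # as @ [b]" "bs @ [a]"] walk_append[of E "a # as" "b # bs @ [a]"] by simp_all
  then have "walk E ((b # bs) @ a # as @ [b])"
    by (intro walk_join[of E "b # bs" a "as @ [b]"])
  then show ?thesis by (simp add: closed_walk_def xs ys)
qed auto

lemma theta_subgraph_mono: "theta_subgraph V' E' \<Longrightarrow> V' \<subseteq> V \<Longrightarrow> E' \<subseteq> E \<Longrightarrow> theta_subgraph V E"
proof -
  assume a: "theta_subgraph V' E'" "V' \<subseteq> V" "E' \<subseteq> E"
  have w: "walk E xs" if "walk E' xs" for xs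
    using that by (rule successively_mono) (use a(3) in auto)
  from a(1) obtain x y as bs cs where t: "distinct (x # y # as @ bs @ cs)"
     "set (x # y # as @ bs @ cs) \<subseteq> V'" "as \<noteq> []" "bs \<noteq> []" "cs \<noteq> []"
     "walk E' (x # as @ [y])" "walk E' (x # bs @ [y])" "walk E' (x # cs @ [y])"
    unfolding theta_subgraph_def by blast
  show ?thesis unfolding theta_subgraph_def
    by (intro exI[of _ x] exI[of _ y] exI[of _ as] exI[of _ bs] exI[of _ cs] conjI
        order_trans[OF t(2) a(2)] w t)
qed

lemma crossed_cycle_mono: "crossed_cycle V' E' \<Longrightarrow> V' \<subseteq> V \<Longrightarrow> E' \<subseteq> E \<Longrightarrow> crossed_cycle V E"
proof -
  assume a: "crossed_cycle V' E'" "V' \<subseteq> V" "E' \<subseteq> E"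
  have w: "walk E xs" if "walk E' xs" for xs
    using that by (rule successively_mono) (use a(3) in auto)
  from a(1) obtain x y z u as bs cs ds where t: "distinct (x # as @ z # bs @ y # cs @ u # ds)"
     "set (x # as @ z # bs @ y # cs @ u # ds) \<subseteq> V'"
     "walk E' (x # as @ z # bs @ y # cs @ u # ds @ [x])" "{x, y} \<in> E'" "{z, u} \<in> E'"
    unfolding crossed_cycle_def by blast
  show ?thesis unfolding crossed_cycle_def
    by (intro exI[of _ x] exI[of _ y] exI[of _ z] exI[of _ u] exI[of _ as] exI[of _ bs] exI[of _ cs]
        exI[of _ ds] conjI order_trans[OF t(2) a(2)] w t subsetD[OF a(3)])
qed

text \<open>If the new vertex is already on the path, everything before it is dropped. Staying in
  the set reachable from \<open>u\<close> later keeps the path off a given cycle.\<close>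

lemma rtrancl_distinct_path:
  assumes "(u, v) \<in> R\<^sup>*"
  shows "\<exists>xs. distinct xs \<and> xs \<noteq> [] \<and> hd xs = u \<and> last xs = v \<and>
    successively (\<lambda>a b. (a, b) \<in> R) xs \<and> set xs \<subseteq> R\<^sup>* `` {u}"
  using assms
proof (induction rule: converse_rtrancl_induct)
  case base
  then show ?case by (intro exI[of _ "[v]"]) auto
next
  case (step u u')
  then obtain xs where xs: "distinct xs" "xs \<noteq> []" "hd xs = u'" "last xs = v"
    "successively (\<lambda>a b. (a, b) \<in> R) xs" "set xs \<subseteq> R\<^sup>* `` {u'}" by blast
  have sub: "set xs \<subseteq> R\<^sup>* `` {u}"
    using xs(6) step(1) by (auto intro: converse_rtrancl_into_rtrancl)
  show ?case
  proof (cases "u \<in> set xs")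
    case True
    then obtain ps qs where "xs = ps @ u # qs" by (meson split_list)
    then show ?thesis using xs sub
      by (intro exI[of _ "u # qs"]) (auto simp: successively_append_iff)
  next
    case False
    then show ?thesis using xs sub step(1)
      by (intro exI[of _ "u # xs"]) (auto simp: successively_Cons)
  qed
qed

text \<open>A separation of order at most one into proper parts: an empty intersection is a
  disconnection, a single vertex a cut vertex.\<close>

definition separated :: "'a set \<Rightarrow> 'a set set \<Rightarrow> bool" where
  "separated V E \<longleftrightarrow> (\<exists>V1 V2 w. V1 \<union> V2 = V \<and> V1 \<noteq> V \<and> V2 \<noteq> V \<and> V1 \<inter> V2 \<subseteq> {w} \<and>
     (\<forall>e\<in>E. e \<subseteq> V1 \<or> e \<subseteq> V2))"

lemma simple_graph_edge:
  assumes "simple_graph V E" "{u, v} \<in> E"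
  shows "u \<in> V" "v \<in> V" "u \<noteq> v"
proof -
  have "\<exists>x y. x \<in> V \<and> y \<in> V \<and> x \<noteq> y \<and> {u, v} = {x, y}"
    using assms by (simp add: simple_graph_def)
  then show "u \<in> V" "v \<in> V" "u \<noteq> v" by (auto simp: doubleton_eq_iff)
qed

lemma simple_graph_restrict:
  assumes "simple_graph V E" "finite U"
  shows "simple_graph U {e \<in> E. e \<subseteq> U}"
  unfolding simple_graph_def
proof (intro conjI ballI assms(2))
  fix e assume e: "e \<in> {e \<in> E. e \<subseteq> U}"
  then have "\<exists>u v. u \<in> V \<and> v \<in> V \<and> u \<noteq> v \<and> e = {u, v}"
    using assms(1) by (simp add: simple_graph_def)
  then show "\<exists>u v. u \<in> U \<and> v \<in> U \<and> u \<noteq> v \<and> e = {u, v}"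
    using e by fastforce
qed

text \<open>Let \<open>K\<close> be the component of \<open>w\<close> off \<open>C\<close> and
  \<open>N\<close> the set of its neighbours on \<open>C\<close>. If \<open>N\<close> had at most
  one element, \<open>K \<union> N\<close> and \<open>V - K\<close> would separate the graph. So two
  vertices of \<open>C\<close> are joined through \<open>K\<close>.\<close>

lemma ear_exists:
  assumes G: "simple_graph V E" and ns: "\<not> separated V E"
    and C: "C \<subseteq> V" "a \<in> C" "b \<in> C" "a \<noteq> b" and w: "w \<in> V" "w \<notin> C"
  obtains x y es where "x \<in> C" "y \<in> C" "x \<noteq> y" "es \<noteq> []" "distinct es" "set es \<subseteq> V - C"
    "walk E (x # es @ [y])"
proof -
  define R where "R = {(u, v). u \<notin> C \<and> v \<notin> C \<and> {u, v} \<in> E}"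
  define K where "K = R\<^sup>* `` {w}"
  define N where "N = {x \<in> C. \<exists>k\<in>K. {x, k} \<in> E}"
  have symR: "sym (R\<^sup>*)"
    by (rule sym_rtrancl) (auto simp: R_def sym_def insert_commute)
  have K: "K \<subseteq> V - C"
  proof
    fix k assume "k \<in> K"
    then have "(w, k) \<in> R\<^sup>*" by (simp add: K_def)
    then show "k \<in> V - C"
      by (induction rule: rtrancl_induct) (use w simple_graph_edge[OF G] in \<open>auto simp: R_def\<close>)
  qed
  have "w \<in> K" by (simp add: K_def)
  have "\<not> N \<subseteq> {z}" for z
  proof
    assume z: "N \<subseteq> {z}"
    have "e \<subseteq> K \<union> N \<or> e \<subseteq> V - K" if "e \<in> E" for e
    proof -
      have "\<exists>u v. u \<in> V \<and> v \<in> V \<and> u \<noteq> v \<and> e = {u, v}"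
        using G that by (simp add: simple_graph_def)
      then obtain u v where e: "u \<in> V" "v \<in> V" "e = {u, v}" by (elim exE conjE)
      have cl: "v \<in> K \<union> N" if "u \<in> K" "{u, v} \<in> E" for u v
      proof (cases "v \<in> C")
        case True
        then show ?thesis using that by (auto simp: N_def insert_commute)
      next
        case False
        then have "(u, v) \<in> R" using that K by (auto simp: R_def)
        then show ?thesis using that by (auto simp: K_def)
      qed
      show ?thesis
        using cl[of u v] cl[of v u] e that by (auto simp: insert_commute)
    qed
    moreover have "(K \<union> N) \<union> (V - K) = V" using K C(1) by (auto simp: N_def)
    moreover have "K \<union> N \<noteq> V"
    proof
      assume "K \<union> N = V"
      then have "{a, b} \<subseteq> N" using K C by blast
      then show False using z C(4) by blast
    qed
    moreover have "V - K \<noteq> V" using w \<open>w \<in> K\<close> by blast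
    moreover have "(K \<union> N) \<inter> (V - K) \<subseteq> {z}" using z by blast
    ultimately have "separated V E" unfolding separated_def by blast
    then show False using ns by simp
  qed
  then obtain x y where xy: "x \<in> N" "y \<in> N" "x \<noteq> y" by blast
  then obtain k l where k: "k \<in> K" "{x, k} \<in> E" and l: "l \<in> K" "{y, l} \<in> E"
    by (auto simp: N_def)
  have "(k, l) \<in> R\<^sup>*"
    using k(1) l(1) symR unfolding K_def by (auto dest: symD intro: rtrancl_trans)
  then obtain es where es: "distinct es" "es \<noteq> []" "hd es = k" "last es = l"
    "successively (\<lambda>a b. (a, b) \<in> R) es" "set es \<subseteq> R\<^sup>* `` {k}"
    using rtrancl_distinct_path by metis
  have "R\<^sup>* `` {k} \<subseteq> K" using k(1) by (auto simp: K_def)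
  then have "set es \<subseteq> V - C" using es(6) K by blast
  moreover have "walk E es"
    using es(5) by (rule successively_mono) (auto simp: R_def)
  then have "walk E (x # es @ [y])"
    using es k l by (auto simp: successively_append_iff successively_Cons insert_commute)
  ultimately show thesis
    using that[of x y es] xy es by (auto simp: N_def)
qed

text \<open>If one of the two stretches of the cycle between \<open>x\<close> and \<open>y\<close>
  has no inner vertex, the ear replaces it and the cycle grows. Otherwise both stretches and the ear
  form a theta.\<close>

lemma extend_or_theta:
  assumes cyc: "closed_walk E (x # as @ y # bs)" and ear: "walk E (x # es @ [y])" "es \<noteq> []"
    and dis: "distinct (x # y # as @ bs @ es)" and V: "set (x # y # as @ bs @ es) \<subseteq> V"
    and nt: "\<not> theta_subgraph V E"
  obtains cs where "closed_walk E cs" "distinct cs" "set cs \<subseteq> V"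
    "length cs > length (x # as @ y # bs)"
proof -
  have "walk E ((x # as @ [y]) @ bs @ [x])" "walk E ((x # as) @ (y # bs @ [x]))"
    using cyc by (auto simp: closed_walk_def)
  then have w: "walk E (x # as @ [y])" "walk E (y # bs @ [x])"
    using walk_append[of E "x # as @ [y]" "bs @ [x]"] walk_append[of E "x # as" "y # bs @ [x]"] by simp_all
  have "walk E (rev (y # bs @ [x]))" "walk E (rev (x # es @ [y]))"
    using w(2) ear by (simp_all only: walk_rev)
  then have r: "walk E (x # rev bs @ [y])" "walk E (y # rev es @ [x])" by simp_all
  consider "as = []" | "bs = []" | "as \<noteq> []" "bs \<noteq> []" by blast
  then show thesis
  proof cases
    case 1
    show thesis
    proof (rule that[of "x # es @ y # bs"])
      show "closed_walk E (x # es @ y # bs)"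
        using walk_join[of E "x # es" y "bs @ [x]"] ear w by (simp add: closed_walk_def)
    qed (use 1 dis V ear in auto)
  next
    case 2
    show thesis
    proof (rule that[of "x # as @ y # rev es"])
      show "closed_walk E (x # as @ y # rev es)"
        using walk_join[of E "x # as" y "rev es @ [x]"] r w by (simp add: closed_walk_def)
    qed (use 2 dis V ear in auto)
  next
    case 3
    have "theta_subgraph V E"
      unfolding theta_subgraph_def
      by (rule exI[of _ x], rule exI[of _ y], rule exI[of _ as], rule exI[of _ "rev bs"], rule exI[of _ es])
        (use 3 dis V w(1) r(1) ear in auto)
    then show thesis using nt by simp
  qed
qed

lemma drop_split_nth: "i \<le> j \<Longrightarrow> j < length xs \<Longrightarrow> drop i xs = take (j - i) (drop i xs) @ xs ! j # drop (Suc j) xs"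
  using id_take_nth_drop[of "j - i" "drop i xs"] by simp

text \<open>The cycle is rotated to start at position \<open>i\<close>; what stood before it becomes
  the end of \<open>ds\<close>.\<close>

lemma closed_walk_split4:
  assumes "i < j" "j < k" "k < l" "l < length xs" "closed_walk E xs" "distinct xs"
  obtains as bs cs ds where "distinct (xs ! i # as @ xs ! j # bs @ xs ! k # cs @ xs ! l # ds)"
    "set (xs ! i # as @ xs ! j # bs @ xs ! k # cs @ xs ! l # ds) = set xs"
    "walk E (xs ! i # as @ xs ! j # bs @ xs ! k # cs @ xs ! l # ds @ [xs ! i])"
proof -
  define p as bs cs where "p = take i xs" and "as = take (j - Suc i) (drop (Suc i) xs)"
    and "bs = take (k - Suc j) (drop (Suc j) xs)" and "cs = take (l - Suc k) (drop (Suc k) xs)"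
  define q where "q = xs ! i # as @ xs ! j # bs @ xs ! k # cs @ xs ! l # drop (Suc l) xs"
  have "xs = p @ xs ! i # drop (Suc i) xs" using assms id_take_nth_drop[of i xs] by (simp add: p_def)
  also have "drop (Suc i) xs = as @ xs ! j # drop (Suc j) xs"
    using drop_split_nth[of "Suc i" j xs] assms by (simp add: as_def)
  also have "drop (Suc j) xs = bs @ xs ! k # drop (Suc k) xs"
    using drop_split_nth[of "Suc j" k xs] assms by (simp add: bs_def)
  also have "drop (Suc k) xs = cs @ xs ! l # drop (Suc l) xs"
    using drop_split_nth[of "Suc k" l xs] assms by (simp add: cs_def)
  finally have xs: "xs = p @ q" by (simp add: q_def)
  have "closed_walk E (q @ p)" using closed_walk_rotate assms(5) xs by metis
  moreover have "distinct (q @ p)" using assms(6) xs by auto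
  moreover have "set (q @ p) = set xs" using arg_cong[OF xs, of set] by auto
  ultimately show thesis
    using that[of as bs cs "drop (Suc l) xs @ p"] by (simp add: q_def closed_walk_def)
qed

text \<open>Only separated graphs recurse, hence the induction on the number of vertices. Otherwise
  the position on a Hamiltonian cycle is the order, and edges that cross in it are crossing chords
  of the cycle.\<close>

lemma no_theta_crossing_imp_noncrossing:
  assumes "simple_graph V E" "\<not> theta_subgraph V E" "\<not> crossed_cycle V E"
  shows "\<exists>f. noncrossing f V E"
  using assms
proof (induction "card V" arbitrary: V E rule: less_induct)
  case less
  note G = less.prems(1)
  have fin: "finite V" using G by (simp add: simple_graph_def)
  consider "separated V E" | "\<not> separated V E" "card V \<le> 1" | "\<not> separated V E" "card V \<ge> 2"
    by (cases "card V \<le> 1") auto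
  then show ?case
  proof cases
    case 1
    then obtain V1 V2 w where s: "V1 \<union> V2 = V" "V1 \<noteq> V" "V2 \<noteq> V" "V1 \<inter> V2 \<subseteq> {w}"
      "\<forall>e\<in>E. e \<subseteq> V1 \<or> e \<subseteq> V2" unfolding separated_def by (elim exE conjE)
    have sub: "\<exists>f. noncrossing f U {e \<in> E. e \<subseteq> U} \<and> (\<forall>u v. u \<in> V1 \<inter> V2 \<longrightarrow> v \<in> U \<longrightarrow> f u \<le> f v)"
      if U: "U \<subset> V" "V1 \<inter> V2 \<subseteq> U" for U
    proof -
      have finU: "finite U" using U fin finite_subset by blast
      have "card U < card V" using U fin by (simp add: psubset_card_mono)
      moreover have "simple_graph U {e \<in> E. e \<subseteq> U}"
        using simple_graph_restrict[OF G finU] .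
      moreover have "\<not> theta_subgraph U {e \<in> E. e \<subseteq> U}"
        using less.prems(2) theta_subgraph_mono[of U _ V E] U by blast
      moreover have "\<not> crossed_cycle U {e \<in> E. e \<subseteq> U}"
        using less.prems(3) crossed_cycle_mono[of U _ V E] U by blast
      ultimately obtain f where f: "noncrossing f U {e \<in> E. e \<subseteq> U}"
        using less.hyps[of U "{e \<in> E. e \<subseteq> U}"] by blast
      show ?thesis
      proof (cases "V1 \<inter> V2 = {}")
        case True
        then show ?thesis using f by blast
      next
        case False
        then have "V1 \<inter> V2 = {w}" "w \<in> U" using s(4) U by auto
        then obtain f' where "noncrossing f' U {e \<in> E. e \<subseteq> U}" "\<forall>v\<in>U. f' w \<le> f' v"
          using noncrossing_rotate[OF finU _ f] by blast
        then show ?thesis using \<open>V1 \<inter> V2 = {w}\<close> by (intro exI[of _ f']) simp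
      qed
    qed
    have sub1: "V1 \<subset> V" "V1 \<inter> V2 \<subseteq> V1" and sub2: "V2 \<subset> V" "V1 \<inter> V2 \<subseteq> V2"
      using s(1-3) by auto
    obtain f1 where f1: "noncrossing f1 V1 {e \<in> E. e \<subseteq> V1}"
      "\<forall>u v. u \<in> V1 \<inter> V2 \<longrightarrow> v \<in> V1 \<longrightarrow> f1 u \<le> f1 v"
      using sub[OF sub1] by (elim exE conjE)
    obtain f2 where f2: "noncrossing f2 V2 {e \<in> E. e \<subseteq> V2}"
      "\<forall>u v. u \<in> V1 \<inter> V2 \<longrightarrow> v \<in> V2 \<longrightarrow> f2 u \<le> f2 v"
      using sub[OF sub2] by (elim exE conjE)
    have "finite V1" "finite V2" using fin s(1) by auto
    then have "\<exists>f. noncrossing f (V1 \<union> V2) E"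
      by (rule noncrossing_glue[OF _ _ f1(1) f2(1)]) (use f1(2) f2(2) s(5) in simp_all)
    then show ?thesis using s(1) by simp
  next
    case 2
    then have "inj_on (\<lambda>_. 0 :: nat) V"
      using fin by (auto simp: inj_on_def card_le_Suc0_iff_eq)
    then have "noncrossing (\<lambda>_. 0) V E" by (simp add: noncrossing_def)
    then show ?thesis by blast
  next
    case 3
    let ?P = "\<lambda>cs. closed_walk E cs \<and> distinct cs \<and> set cs \<subseteq> V \<and> length cs \<ge> 2"
    have "E \<noteq> {}"
    proof
      assume "E = {}"
      obtain v where v: "v \<in> V" using 3 by fastforce
      have "{v} \<noteq> V" using 3 by auto
      then have "separated V E" unfolding separated_def
        using v \<open>E = {}\<close> by (intro exI[of _ "{v}"] exI[of _ "V - {v}"]) auto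
      then show False using 3 by simp
    qed
    then obtain e where e: "e \<in> E" by blast
    then have "\<exists>u v. u \<in> V \<and> v \<in> V \<and> u \<noteq> v \<and> e = {u, v}"
      using G by (simp add: simple_graph_def)
    then obtain u v where "u \<in> V" "v \<in> V" "u \<noteq> v" "{u, v} \<in> E" using e by blast
    then have "?P [u, v]" by (simp add: closed_walk_def insert_commute)
    moreover have "length cs < Suc (card V)" if "?P cs" for cs
      using that fin card_mono[of V "set cs"] by (simp add: distinct_card)
    ultimately obtain cs where cs: "?P cs" and max: "\<And>ds. ?P ds \<Longrightarrow> length ds \<le> length cs"
      using ex_has_greatest_nat[of ?P "[u, v]" length "Suc (card V)"] by blast
    have VC: "V \<subseteq> set cs"
    proof
      fix w assume w: "w \<in> V"
      show "w \<in> set cs"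
      proof (rule ccontr)
        assume nw: "w \<notin> set cs"
        obtain a b rest where ab: "cs = a # b # rest"
          using cs by (metis One_nat_def Suc_1 Suc_le_length_iff)
        obtain x y es where e: "x \<in> set cs" "y \<in> set cs" "x \<noteq> y" "es \<noteq> []" "distinct es"
          "set es \<subseteq> V - set cs" "walk E (x # es @ [y])"
          using ear_exists[OF G 3(1), of "set cs" a b w] cs ab w nw by auto
        obtain p q where pq: "cs = p @ x # q" using e(1) by (meson split_list)
        then have "y \<in> set (q @ p)" using e by auto
        then obtain as bs where ys: "q @ p = as @ y # bs" by (meson split_list)
        have rot: "(x # q) @ p = x # as @ y # bs" using ys by simp
        then have cw: "closed_walk E (x # as @ y # bs)"
          using closed_walk_rotate[of E p "x # q"] cs pq by simp
        have st: "set cs = insert x (insert y (set as \<union> set bs))"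
          using arg_cong[OF rot, of set] pq by auto
        have len: "length cs = length (x # as @ y # bs)"
          using arg_cong[OF rot, of length] pq by simp
        have "distinct ((x # q) @ p)" using cs pq by auto
        then have "distinct (x # as @ y # bs)" by (simp only: rot)
        then have d: "distinct (x # y # as @ bs @ es)"
          using e st by auto
        obtain ds where "closed_walk E ds" "distinct ds" "set ds \<subseteq> V" "length ds > length (x # as @ y # bs)"
          using extend_or_theta[OF cw e(7,4) d _ less.prems(2)] e(6) st cs by auto
        then show False using max[of ds] len by simp
      qed
    qed
    then have Vcs: "set cs = V" using cs by blast
    have "\<forall>v\<in>V. \<exists>i. i < length cs \<and> cs ! i = v" using Vcs by (metis in_set_conv_nth)
    then obtain f where f: "\<forall>v\<in>V. f v < length cs \<and> cs ! f v = v" by (rule bchoice[THEN exE])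
    have "inj_on f V" using f by (metis inj_onI)
    moreover have False if V: "a \<in> V" "b \<in> V" "c \<in> V" "d \<in> V" and lt: "f a < f b" "f b < f c" "f c < f d"
      and ed: "{a, c} \<in> E" "{b, d} \<in> E" for a b c d
    proof -
      have nth: "cs ! f a = a" "cs ! f b = b" "cs ! f c = c" "cs ! f d = d" "f d < length cs" using f V by auto
      have cl: "closed_walk E cs" "distinct cs" using cs by auto
      obtain as bs cs' ds where "distinct (a # as @ b # bs @ c # cs' @ d # ds)"
        "set (a # as @ b # bs @ c # cs' @ d # ds) = set cs"
        "walk E (a # as @ b # bs @ c # cs' @ d # ds @ [a])"
        using closed_walk_split4[OF lt nth(5) cl] unfolding nth by metis
      then have "crossed_cycle V E" unfolding crossed_cycle_def using ed Vcs by blast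
      then show False using less.prems(3) by simp
    qed
    ultimately have "noncrossing f V E" unfolding noncrossing_def by blast
    then show ?thesis by blast
  qed
qed

section \<open>Triangulated polygons as segment graphs\<close>

text \<open>An interval representation of \<open>A\<close> on \<open>S\<close>. The intervals are
  closed, so touching in one point makes vertices adjacent; a point will become a unit grid
  edge.\<close>

definition segments :: "'b set \<Rightarrow> ('b \<Rightarrow> 'b \<Rightarrow> bool) \<Rightarrow> ('b \<Rightarrow> int) \<Rightarrow> ('b \<Rightarrow> int) \<Rightarrow> bool" where
  "segments S A l r \<longleftrightarrow> (\<forall>v\<in>S. l v \<le> r v) \<and>
     (\<forall>u\<in>S. \<forall>v\<in>S. u \<noteq> v \<longrightarrow> (A u v \<longleftrightarrow> l u \<le> r v \<and> l v \<le> r u))"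

text \<open>The right end \<open>R\<close> is reached by \<open>y\<close> and \<open>z\<close>
  alone, so a vertex adjacent to just these two can be attached there.\<close>

definition capped :: "'b set \<Rightarrow> ('b \<Rightarrow> 'b \<Rightarrow> bool) \<Rightarrow> 'b \<Rightarrow> 'b \<Rightarrow> bool" where
  "capped S A y z \<longleftrightarrow> (\<exists>l r R. segments S A l r \<and> r y = R \<and> r z = R \<and> (\<forall>v\<in>S - {y, z}. r v < R))"

lemma segmentsD:
  assumes "segments S A l r"
  shows "v \<in> S \<Longrightarrow> l v \<le> r v"
    and "u \<in> S \<Longrightarrow> v \<in> S \<Longrightarrow> u \<noteq> v \<Longrightarrow> A u v \<longleftrightarrow> l u \<le> r v \<and> l v \<le> r u"
  using assms unfolding segments_def by blast+

lemma capped_commute: "capped S A y z \<longleftrightarrow> capped S A z y"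
proof -
  have "capped S A z y" if "capped S A y z" for y z
  proof -
    obtain l r R where "segments S A l r" "r y = R" "r z = R" "\<forall>v\<in>S - {y, z}. r v < R"
      using \<open>capped S A y z\<close> unfolding capped_def by (elim exE conjE)
    then show ?thesis
      unfolding capped_def by (intro exI[of _ l] exI[of _ r] exI[of _ R]) auto
  qed
  then show ?thesis by blast
qed

lemma capped_edge:
  assumes "A y z" "A z y"
  shows "capped {y, z} A y z"
  unfolding capped_def segments_def
  by (rule exI[of _ "\<lambda>_. 0"], rule exI[of _ "\<lambda>_. 0"], rule exI[of _ 0]) (use assms in auto)

text \<open>\<open>x\<close> receives the interval from \<open>R\<close> to \<open>R + 1\<close> and
  \<open>z\<close> is prolonged to \<open>R + 1\<close>, while \<open>y\<close> stops at
  \<open>R\<close>. So \<open>x\<close> meets only \<open>y\<close> and \<open>z\<close>, and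
  \<open>x\<close> and \<open>z\<close> form the new cap.\<close>

lemma capped_insert:
  assumes S: "capped S A y z" and yz: "y \<in> S" "z \<in> S" "y \<noteq> z" and x: "x \<notin> S"
    and sym: "\<And>u v. A u v \<Longrightarrow> A v u"
    and adj: "A x y" "A x z" and nadj: "\<And>v. v \<in> S - {y, z} \<Longrightarrow> \<not> A x v"
  shows "capped (insert x S) A x z"
proof -
  obtain l r R where seg: "segments S A l r" and R: "r y = R" "r z = R" "\<And>v. v \<in> S - {y, z} \<Longrightarrow> r v < R"
    using S unfolding capped_def by blast
  define l' r' where "l' = l(x := R)" and "r' = r(x := R + 1, z := R + 1)"
  have xz: "x \<noteq> z" "x \<noteq> y" using x yz by auto
  have le: "r v \<le> R" if "v \<in> S" for v using R that by (cases "v \<in> {y, z}") (auto simp: less_imp_le)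
  have lr: "l v \<le> r v" "l v \<le> R" if "v \<in> S" for v
    using segmentsD(1)[OF seg that] le[OF that] by auto
  have x': "l' x = R" "r' x = R + 1" by (auto simp: l'_def r'_def xz)
  have S': "l' v = l v" "r' v = (if v = z then R + 1 else r v)" if "v \<in> S" for v
    using that x by (auto simp: l'_def r'_def)
  have xv: "A x v \<longleftrightarrow> l' x \<le> r' v \<and> l' v \<le> r' x" if v: "v \<in> S" for v
  proof -
    consider "v = y" | "v = z" | "v \<in> S - {y, z}" using v by blast
    then show ?thesis
    proof cases
      case 1
      then show ?thesis using v x' S' lr[of v] adj R yz by auto
    next
      case 2
      then show ?thesis using v x' S' lr[of v] adj by auto
    next
      case 3
      then have "\<not> A x v" "r v < R" using nadj R(3) by auto
      then show ?thesis using 3 x' S' by auto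
    qed
  qed
  have "A u v \<longleftrightarrow> l' u \<le> r' v \<and> l' v \<le> r' u" if uv: "u \<in> insert x S" "v \<in> insert x S" "u \<noteq> v" for u v
  proof -
    consider "u = x" "v \<in> S" | "v = x" "u \<in> S" | "u \<in> S" "v \<in> S" using uv by blast
    then show ?thesis
    proof cases
      case 1 then show ?thesis using xv by blast
    next
      case 2 then show ?thesis using xv[of u] sym[of u x] sym[of x u] by blast
    next
      case 3
      have zz: "l w \<le> R" "l w \<le> R + 1" if "w \<in> S" for w using lr(2)[OF that] by auto
      show ?thesis
        using segmentsD(2)[OF seg 3 uv(3)] 3 S' R(2) zz[of u] zz[of v] by auto
    qed
  qed
  moreover have "l' v \<le> r' v" if "v \<in> insert x S" for v
    using that x' S'[of v] lr[of v] by (cases "v = x") auto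
  ultimately have "segments (insert x S) A l' r'" unfolding segments_def by blast
  moreover have "r' v < R + 1" if "v \<in> insert x S - {x, z}" for v
    using that S' le[of v] by auto
  moreover have "r' z = R + 1" by (simp add: r'_def)
  ultimately show ?thesis using x' unfolding capped_def by blast
qed

text \<open>The picture of \<open>T\<close> is reflected by t -> R1 + 2 + R2 - t and set to the
  right of that of \<open>S\<close>, so the caps come to lie at \<open>R1\<close> and
  \<open>R1 + 2\<close>. The segment of \<open>m\<close> bridges the gap. The point
  \<open>R1 + 1\<close> in it is given to \<open>a\<close> and \<open>b\<close> as well and realizes
  their edge.\<close>

lemma segments_glue:
  assumes S: "capped S A a m" and T: "capped T A m b" and ST: "S \<inter> T = {m}"
    and mem: "a \<in> S" "b \<in> T" "a \<noteq> m" "b \<noteq> m"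
    and sym: "\<And>u v. A u v \<Longrightarrow> A v u" and ab: "A a b"
    and nadj: "\<And>u v. u \<in> S - {m} \<Longrightarrow> v \<in> T - {m} \<Longrightarrow> A u v \<Longrightarrow> u = a \<and> v = b"
  shows "\<exists>l r. segments (S \<union> T) A l r"
proof -
  obtain l1 r1 R1 where seg1: "segments S A l1 r1" and R1: "r1 a = R1" "r1 m = R1"
    and lt1: "\<And>v. v \<in> S - {a, m} \<Longrightarrow> r1 v < R1"
    using S unfolding capped_def by blast
  obtain l2 r2 R2 where seg2: "segments T A l2 r2" and R2: "r2 m = R2" "r2 b = R2"
    and lt2: "\<And>v. v \<in> T - {m, b} \<Longrightarrow> r2 v < R2"
    using T unfolding capped_def by blast
  define l where "l v = (if v \<in> S then l1 v else if v = b then R1 + 1 else R1 + 2 + R2 - r2 v)" for v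
  define r where "r v = (if v \<in> T then R1 + 2 + R2 - l2 v else if v = a then R1 + 1 else r1 v)" for v
  have m: "m \<in> S" "m \<in> T" using ST by auto
  have out: "a \<notin> T" "b \<notin> S" using ST mem by auto
  have le1: "r1 v \<le> R1" "l1 v \<le> r1 v" if "v \<in> S" for v
    using R1 lt1[of v] that segmentsD(1)[OF seg1 that] by (cases "v \<in> {a, m}"; auto)+
  have le2: "r2 v \<le> R2" "l2 v \<le> r2 v" if "v \<in> T" for v
    using R2 lt2[of v] that segmentsD(1)[OF seg2 that] by (cases "v \<in> {m, b}"; auto)+
  have S1: "l v = l1 v" "r v = (if v = a then R1 + 1 else r1 v)" if "v \<in> S" "v \<noteq> m" for v
    using that ST by (auto simp: l_def r_def)
  have T1: "l v = (if v = b then R1 + 1 else R1 + 2 + R2 - r2 v)" "r v = R1 + 2 + R2 - l2 v"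
    if "v \<in> T" "v \<noteq> m" for v
    using that ST by (auto simp: l_def r_def)
  have m1: "l m = l1 m" "r m = R1 + 2 + R2 - l2 m" using m by (auto simp: l_def r_def)
  have lem: "l1 m \<le> R1" "l2 m \<le> R2" using le1[OF m(1)] le2[OF m(2)] R1 R2 by auto
  have valid: "l v \<le> r v" if v: "v \<in> S \<union> T" for v
  proof -
    consider "v = m" | "v \<in> S" "v \<noteq> m" | "v \<in> T" "v \<noteq> m" using v by blast
    then show ?thesis
    proof cases
      case 1 then show ?thesis using m1 lem by simp
    next
      case 2 then show ?thesis using S1[OF 2] le1[OF 2(1)] by auto
    next
      case 3 then show ?thesis using T1[OF 3] le2[OF 3(1)] by auto
    qed
  qed
  have SS: "A u v \<longleftrightarrow> l u \<le> r v \<and> l v \<le> r u" if "u \<in> S" "v \<in> S" "u \<noteq> v" for u v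
  proof -
    have "A u v \<longleftrightarrow> l1 u \<le> r1 v \<and> l1 v \<le> r1 u" using segmentsD(2)[OF seg1 that] .
    then show ?thesis
      using that S1[of u] S1[of v] m1 lem le1[of u] le1[of v] R1 mem(3) by (cases "u = m"; cases "v = m"; auto)
  qed
  have TT: "A u v \<longleftrightarrow> l u \<le> r v \<and> l v \<le> r u" if "u \<in> T" "v \<in> T" "u \<noteq> v" for u v
  proof -
    have "A u v \<longleftrightarrow> l2 u \<le> r2 v \<and> l2 v \<le> r2 u" using segmentsD(2)[OF seg2 that] .
    then show ?thesis
      using that T1[of u] T1[of v] m1 lem le2[of u] le2[of v] R2 mem(4) by (cases "u = m"; cases "v = m"; auto)
  qed
  have cross: "A u v \<longleftrightarrow> l u \<le> r v \<and> l v \<le> r u" if uv: "u \<in> S - {m}" "v \<in> T - {m}" for u v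
  proof (cases "u = a \<and> v = b")
    case True
    then show ?thesis using ab S1[of u] T1[of v] uv le1[of u] le2[of v] by auto
  next
    case False
    then have "\<not> A u v" using nadj[OF uv] by blast
    moreover have "\<not> l v \<le> r u"
      using False uv S1[of u] T1[of v] le1[of u] lt1[of u] lt2[of v] by (auto split: if_splits)
    ultimately show ?thesis by blast
  qed
  have "A u v \<longleftrightarrow> l u \<le> r v \<and> l v \<le> r u" if uv: "u \<in> S \<union> T" "v \<in> S \<union> T" "u \<noteq> v" for u v
  proof -
    consider "u \<in> S" "v \<in> S" | "u \<in> T" "v \<in> T" | "u \<in> S - {m}" "v \<in> T - {m}" | "v \<in> S - {m}" "u \<in> T - {m}"
      using uv m by blast
    then show ?thesis
    proof cases
      case 4 then show ?thesis using cross[of v u] sym[of u v] sym[of v u] by blast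
    qed (use SS TT cross uv in blast)+
  qed
  then show ?thesis using valid unfolding segments_def by blast
qed

text \<open>A triangulated convex \<open>n\<close>-gon, encoded without faces as a maximal noncrossing chord system.\<close>
locale triangulation =
  fixes n :: nat and A :: "nat \<Rightarrow> nat \<Rightarrow> bool"
  assumes sym: "A i k \<Longrightarrow> A k i"
    and irrefl: "A i k \<Longrightarrow> i \<noteq> k"
    and maximal: "i < k \<Longrightarrow> k < n \<Longrightarrow>
      A i k \<longleftrightarrow> (\<forall>c d. i < c \<longrightarrow> c < k \<longrightarrow> d < n \<longrightarrow> d < i \<or> k < d \<longrightarrow> \<not> A c d)"
begin

lemma not_crossing:
  assumes "A i k" "i < c" "c < k" "k < n" "d < n" "d < i \<or> k < d"
  shows "\<not> A c d" "\<not> A d c"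
  using assms maximal[of i k] sym by (meson less_trans)+

lemma side: "Suc i < n \<Longrightarrow> A i (Suc i)"
  using maximal[of i "Suc i"] by auto

text \<open>Let \<open>j\<close> be the last neighbour of \<open>i\<close> before \<open>k\<close>.
  An edge from \<open>c\<close> between \<open>j\<close> and \<open>k\<close> that crosses
  \<open>jk\<close> cannot leave \<open>i..k\<close>, cannot end at \<open>i\<close> by the choice
  of \<open>j\<close>, and cannot end between \<open>i\<close> and \<open>j\<close>, where it would
  cross \<open>ij\<close>. So maximality supplies \<open>jk\<close>.\<close>

lemma apex:
  assumes ik: "A i k" "Suc i < k" "k < n"
  obtains j where "i < j" "j < k" "A i j" "A j k"
proof -
  define j where "j = Max {j. j < k \<and> i < j \<and> A i j}"
  have fin: "finite {j. j < k \<and> i < j \<and> A i j}" by simp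
  have "Suc i \<in> {j. j < k \<and> i < j \<and> A i j}" using side assms by auto
  then have j: "j < k" "i < j" "A i j" using Max_in[OF fin] unfolding j_def by blast+
  have max: "x \<le> j" if "x < k" "i < x" "A i x" for x
    using Max_ge[OF fin] that unfolding j_def by blast
  have "A j k"
  proof (subst maximal[OF j(1) ik(3)], intro allI impI notI)
    fix c d assume c: "j < c" "c < k" and d: "d < n" "d < j \<or> k < d" and "A c d"
    have "\<not> k < d" "\<not> d < i"
      using not_crossing[OF ik(1), of c d] c d j \<open>A c d\<close> ik(3) by auto
    moreover have "d \<noteq> i" using max[of c] c j sym \<open>A c d\<close> by auto
    ultimately have "i < d" "d < j" using d(2) by auto
    then show False
      using not_crossing[OF j(3), of d c] c j \<open>A c d\<close> ik(3) by auto
  qed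
  then show thesis using that j by blast
qed

text \<open>The vertex \<open>q\<close> completes a triangle on the far side of \<open>ik\<close>.
  By \<open>no_inner\<close> the triangle \<open>ijk\<close> has \<open>ij\<close> or
  \<open>jk\<close> as a polygon side, so cutting off one vertex leaves a single smaller polygon.
  The vertex cut off is the \<open>q\<close> of that polygon.\<close>

lemma capped_polygon:
  assumes no_inner: "\<And>i j k q. i < j \<Longrightarrow> j < k \<Longrightarrow> k < n \<Longrightarrow> q < n \<Longrightarrow> q < i \<or> k < q \<Longrightarrow> A i j \<Longrightarrow> A j k \<Longrightarrow>
      A i k \<Longrightarrow> A q i \<Longrightarrow> A q k \<Longrightarrow> j = Suc i \<or> k = Suc j"
    and "A i k" "i < k" "k < n" "q < n" "q < i \<or> k < q" "A q i" "A q k"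
  shows "capped {i..k} A i k"
  using assms(2-)
proof (induction "k - i" arbitrary: i k q rule: less_induct)
  case less
  show ?case
  proof (cases "k = Suc i")
    case True
    then have "{i..k} = {i, k}" by auto
    then show ?thesis using capped_edge[of A i k] less.prems sym by simp
  next
    case False
    then obtain j where j: "i < j" "j < k" "A i j" "A j k"
      using apex[of i k] less.prems by auto
    have "j = Suc i \<or> k = Suc j" using no_inner j less.prems by blast
    then show ?thesis
    proof
      assume ji: "j = Suc i"
      have "capped {j..k} A j k"
        using less.hyps[of k j i] j less.prems sym by auto
      then have "capped (insert i {j..k}) A i k"
        by (rule capped_insert)
          (use j less.prems not_crossing[OF j(4), of _ i] sym in auto)
      moreover have "insert i {j..k} = {i..k}" using ji j by auto
      ultimately show ?thesis by simp
    next
      assume kj: "k = Suc j"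
      have "capped {i..j} A j i"
        using less.hyps[of j i k] j less.prems sym capped_commute[of "{i..j}" A i j] by auto
      then have "capped (insert k {i..j}) A k i"
        by (rule capped_insert)
          (use j less.prems not_crossing[OF j(3), of _ k] sym in auto)
      moreover have "insert k {i..j} = {i..k}" using kj j by auto
      ultimately show ?thesis using capped_commute by metis
    qed
  qed
qed

text \<open>The triangle at the side from \<open>0\<close> to \<open>m\<close> has two further
  sides, each with a strip behind it. Each strip has the opposite corner of this triangle as its
  \<open>q\<close>, and the two are glued at the apex \<open>j\<close>.\<close>

lemma segments_exist:
  assumes no_inner: "\<And>i j k q. i < j \<Longrightarrow> j < k \<Longrightarrow> k < n \<Longrightarrow> q < n \<Longrightarrow> q < i \<or> k < q \<Longrightarrow> A i j \<Longrightarrow> A j k \<Longrightarrow>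
      A i k \<Longrightarrow> A q i \<Longrightarrow> A q k \<Longrightarrow> j = Suc i \<or> k = Suc j"
  shows "\<exists>l r. segments {..<n} A l r"
proof -
  consider "n \<le> 1" | "n = 2" | "n \<ge> 3" by linarith
  then show ?thesis
  proof cases
    case 1
    then have "segments {..<n} A (\<lambda>_. 0) (\<lambda>_. 0)"
      unfolding segments_def by auto
    then show ?thesis by blast
  next
    case 2
    then have "capped {0, 1} A 0 1" using capped_edge[of A 0 1] side[of 0] sym by simp
    moreover have "{..<n} = {0, 1}" using 2 by auto
    ultimately show ?thesis unfolding capped_def by metis
  next
    case 3
    define m where "m = n - 1"
    have m: "Suc 0 < m" "m < n" "n = Suc m" using 3 by (auto simp: m_def)
    have 0: "A 0 m" using maximal[of 0 m] m by auto
    obtain j where j: "0 < j" "j < m" "A 0 j" "A j m" using apex[OF 0 m(1,2)] by blast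
    have polygon: "capped {i..k} A i k"
      if "A i k" "i < k" "k < n" "q < n" "q < i \<or> k < q" "A q i" "A q k" for i k q
      by (rule capped_polygon[OF _ that]) (rule no_inner)
    have "\<exists>l r. segments ({0..j} \<union> {j..m}) A l r"
    proof (rule segments_glue)
      show "capped {0..j} A 0 j"
        by (rule polygon[of 0 j m]) (use j m 0 sym in auto)
      show "capped {j..m} A j m"
        by (rule polygon[of j m 0]) (use j m 0 sym in auto)
      show "u = 0 \<and> v = m" if "u \<in> {0..j} - {j}" "v \<in> {j..m} - {j}" "A u v" for u v
      proof -
        have uv: "u < j" "j < v" "v \<le> m" using that by auto
        have "\<not> 0 < u" using not_crossing(1)[OF j(3), of u v] uv j m that(3) by linarith
        moreover have "\<not> v < m" using not_crossing(2)[OF j(4), of v u] uv j m that(3) by linarith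
        ultimately show ?thesis using uv by simp
      qed
    qed (use j 0 sym in auto)
    moreover have "{0..j} \<union> {j..m} = {..<n}" using j m by auto
    ultimately show ?thesis by simp
  qed
qed

end

section \<open>From inner triangles to induced copies, and from intervals to grid paths\<close>

text \<open>If \<open>ij\<close> and \<open>jk\<close> were both diagonals, they would have apexes
  \<open>p\<close> and \<open>s\<close> behind them, as \<open>ik\<close> has \<open>q\<close>. Each
  pair that must be nonadjacent is separated by a side of the triangle \<open>ijk\<close>, so the
  copy is induced.\<close>

lemma no_S3_imp_no_inner:
  assumes "triangulation n (\<lambda>i k. {g i, g k} \<in> E)" and g: "inj_on g {..<n}" "g ` {..<n} \<subseteq> V"
    and S3: "\<not> has_induced_copy S3_V S3_E V E"
    and ord: "i < j" "j < k" "k < n" "q < n" "q < i \<or> k < q"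
    and adj: "{g i, g j} \<in> E" "{g j, g k} \<in> E" "{g i, g k} \<in> E" "{g q, g i} \<in> E" "{g q, g k} \<in> E"
  shows "j = Suc i \<or> k = Suc j"
proof (rule ccontr)
  assume "\<not> ?thesis"
  then have lt: "Suc i < j" "Suc j < k" using ord by auto
  interpret triangulation n "\<lambda>i k. {g i, g k} \<in> E" by fact
  obtain p where p: "i < p" "p < j" "{g i, g p} \<in> E" "{g p, g j} \<in> E"
    using apex[OF adj(1) lt(1)] ord by auto
  obtain s where s: "j < s" "s < k" "{g j, g s} \<in> E" "{g s, g k} \<in> E"
    using apex[OF adj(2) lt(2)] ord by auto
  note nc = not_crossing[OF adj(1), of p k] not_crossing[OF adj(1), of p s] not_crossing[OF adj(1), of p q]
    not_crossing[OF adj(2), of s i] not_crossing[OF adj(2), of s q] not_crossing[OF adj(3), of j q]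
  have n: "{g p, g k} \<notin> E" "{g p, g s} \<notin> E" "{g p, g q} \<notin> E" "{g s, g i} \<notin> E" "{g s, g q} \<notin> E" "{g j, g q} \<notin> E"
    using nc p s ord by auto
  \<comment> \<open>The order follows the numbering of \<open>S3_V\<close>: the triangle is 0, 1, 2,
    and the vertices 3, 4, 5 lie behind its sides 01, 12, 02.\<close>
  define f where "f = nth (map g [i, j, k, p, s, q])"
  have f: "f 0 = g i" "f 1 = g j" "f 2 = g k" "f 3 = g p" "f 4 = g s" "f 5 = g q"
    by (simp_all add: f_def eval_nat_numeral)
  have sub: "set [i, j, k, p, s, q] \<subseteq> {..<n}" using ord p s by auto
  have "distinct [i, j, k, p, s, q]" using ord p s by auto
  then have dist: "distinct (map g [i, j, k, p, s, q])"
    using g(1) sub by (metis distinct_map inj_on_subset)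
  have S3_V: "S3_V = {..<length (map g [i, j, k, p, s, q])}"
    by (auto simp: S3_V_def)
  have "inj_on f S3_V" unfolding f_def S3_V using dist by (simp add: inj_on_nth del: list.map)
  moreover have "f ` S3_V \<subseteq> V"
    using g(2) ord p s by (auto simp: S3_V_def f[simplified])
  moreover have "\<forall>a\<in>S3_V. \<forall>b\<in>S3_V. a \<noteq> b \<longrightarrow> ({f a, f b} \<in> E \<longleftrightarrow> {a, b} \<in> S3_E)"
    unfolding S3_V_def using adj p s n
    by (simp add: f[simplified] S3_E_def doubleton_eq_iff insert_commute)
  ultimately have "has_induced_copy S3_V S3_E V E" unfolding has_induced_copy_def by blast
  then show False using S3 by simp
qed

text \<open>The integer point \<open>x\<close> becomes the grid edge from \<open>(x, 0)\<close> to
  \<open>(x + 1, 0)\<close>. Hence the path runs on to \<open>r v + 1\<close>, and even a one-point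
  segment owns an edge.\<close>

lemma segments_imp_in_B0:
  assumes "segments V (\<lambda>u v. {u, v} \<in> E) l r"
  shows "in_B0 V E"
proof -
  define P where "P v = map (\<lambda>x. (x, 0 :: int)) [l v..r v + 1]" for v
  have nth: "P v ! i = (l v + int i, 0)" if "i < length (P v)" for v i
    using that by (simp add: P_def)
  have edges: "path_edges (P v) = (\<lambda>x. {(x, 0), (x + 1, 0)}) ` {l v..r v}" if "v \<in> V" for v
  proof -
    have le: "l v \<le> r v" using assms that by (simp add: segments_def)
    then have len: "Suc i < length (P v) \<longleftrightarrow> int i \<le> r v - l v" for i
      by (auto simp: P_def)
    have "path_edges (P v) = {{(l v + int i, 0), (l v + int i + 1, 0)} | i. int i \<le> r v - l v}"
    proof -
      have "{P v ! i, P v ! Suc i} = {(l v + int i, 0), (l v + int i + 1, 0)}" if "Suc i < length (P v)" for i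
        using nth[of i v] nth[of "Suc i" v] that by (simp add: ac_simps)
      then show ?thesis
        unfolding path_edges_def len[symmetric] by (intro Collect_cong) metis
    qed
    also have "\<dots> = (\<lambda>x. {(x, 0), (x + 1, 0)}) ` {l v..r v}"
    proof (intro set_eqI iffI)
      fix e assume "e \<in> {{(l v + int i, 0), (l v + int i + 1, 0)} | i. int i \<le> r v - l v}"
      then show "e \<in> (\<lambda>x. {(x, 0), (x + 1, 0)}) ` {l v..r v}" by auto
    next
      fix e :: "gpoint set" assume "e \<in> (\<lambda>x. {(x, 0), (x + 1, 0)}) ` {l v..r v}"
      then obtain x where x: "e = {(x, 0), (x + 1, 0)}" "l v \<le> x" "x \<le> r v" by auto
      then show "e \<in> {{(l v + int i, 0), (l v + int i + 1, 0)} | i. int i \<le> r v - l v}"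
        by (intro CollectI exI[of _ "nat (x - l v)"]) auto
    qed
    finally show ?thesis .
  qed
  have "EPG_rep V E P"
    unfolding EPG_rep_def
  proof (intro conjI ballI impI)
    fix v assume "v \<in> V"
    then have "l v \<le> r v" using assms by (simp add: segments_def)
    then show "grid_path (P v)"
      unfolding grid_path_def using nth[of _ v]
      by (auto simp: P_def distinct_map inj_on_def grid_adj_def)
  next
    fix u v assume uv: "u \<in> V" "v \<in> V" "u \<noteq> v"
    have inj: "inj (\<lambda>x :: int. {(x, 0 :: int), (x + 1, 0)})"
    proof (rule injI)
      fix x y :: int assume "{(x, 0 :: int), (x + 1, 0)} = {(y, 0), (y + 1, 0)}"
      then have "(x = y) \<or> (x = y + 1 \<and> x + 1 = y)" unfolding doubleton_eq_iff by auto
      then show "x = y" by linarith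
    qed
    have "path_edges (P u) \<inter> path_edges (P v) \<noteq> {} \<longleftrightarrow> {l u..r u} \<inter> {l v..r v} \<noteq> {}"
      unfolding edges[OF uv(1)] edges[OF uv(2)] image_Int[OF inj, symmetric] by simp
    also have "\<dots> \<longleftrightarrow> l u \<le> r v \<and> l v \<le> r u"
    proof -
      have "l u \<le> r u" "l v \<le> r v" using assms uv by (auto simp: segments_def)
      then show ?thesis by (auto simp: Int_atLeastAtMost)
    qed
    also have "\<dots> \<longleftrightarrow> {u, v} \<in> E" using assms uv by (auto simp: segments_def)
    finally show "{u, v} \<in> E \<longleftrightarrow> path_edges (P u) \<inter> path_edges (P v) \<noteq> {}" by simp
  qed
  moreover have "bendless (P v)" for v by (auto simp: bendless_def P_def)
  ultimately show ?thesis unfolding in_B0_def by blast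
qed

lemma triangulation_imp_in_B0:
  assumes tri: "triangulation n (\<lambda>i k. {g i, g k} \<in> E)" and g: "bij_betw g {..<n} V"
    and S3: "\<not> has_induced_copy S3_V S3_E V E"
  shows "in_B0 V E"
proof -
  have g': "inj_on g {..<n}" "g ` {..<n} = V" using g by (auto simp: bij_betw_def)
  have "\<exists>l r. segments {..<n} (\<lambda>i k. {g i, g k} \<in> E) l r"
  proof (rule triangulation.segments_exist[OF tri])
    fix i j k q
    assume "i < j" "j < k" "k < n" "q < n" "q < i \<or> k < q" "{g i, g j} \<in> E" "{g j, g k} \<in> E"
      "{g i, g k} \<in> E" "{g q, g i} \<in> E" "{g q, g k} \<in> E"
    then show "j = Suc i \<or> k = Suc j"
      by (rule no_S3_imp_no_inner[OF tri g'(1) eq_refl[OF g'(2)] S3])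
  qed
  then obtain l r where seg: "segments {..<n} (\<lambda>i k. {g i, g k} \<in> E) l r" by blast
  define h where "h = the_inv_into {..<n} g"
  have h: "h v < n" "g (h v) = v" if "v \<in> V" for v
    using that g' the_inv_into_into[OF g'(1), of v "{..<n}"] f_the_inv_into_f[OF g'(1), of v]
    by (auto simp: h_def)
  have "segments V (\<lambda>u v. {u, v} \<in> E) (l \<circ> h) (r \<circ> h)"
    unfolding segments_def
  proof (intro conjI ballI impI)
    fix v assume "v \<in> V"
    then show "(l \<circ> h) v \<le> (r \<circ> h) v" using segmentsD(1)[OF seg] h by simp
  next
    fix u v assume uv: "u \<in> V" "v \<in> V" "u \<noteq> v"
    then have "h u \<noteq> h v" using h by metis
    then show "({u, v} \<in> E) = ((l \<circ> h) u \<le> (r \<circ> h) v \<and> (l \<circ> h) v \<le> (r \<circ> h) u)"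
      using segmentsD(2)[OF seg, of "h u" "h v"] h uv by simp
  qed
  then show ?thesis by (rule segments_imp_in_B0)
qed

section \<open>Bendless paths\<close>

text \<open>Coordinates for grid edges: \<open>h\<close> tells horizontal from vertical,
  \<open>c\<close> is the line, \<open>x\<close> the smaller end on it.\<close>

definition line_edge :: "bool \<Rightarrow> int \<Rightarrow> int \<Rightarrow> gpoint set" where
  "line_edge h c x = (if h then {(x, c), (x + 1, c)} else {(c, x), (c, x + 1)})"

lemma line_edge_inject: "line_edge h c x = line_edge h' c' x' \<longleftrightarrow> h = h' \<and> c = c' \<and> x = x'"
  by (auto simp: line_edge_def doubleton_eq_iff)

text \<open>A discrete intermediate value principle, with the two indices in either order.\<close>

lemma exists_crossing_step:
  assumes "P (i::nat)" "\<not> P j" 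
  shows "\<exists>k. min i j \<le> k \<and> k < max i j \<and> P k \<noteq> P (Suc k)"
proof -
  have *: "\<exists>k. i \<le> k \<and> k < j \<and> P k \<noteq> P (Suc k)" if "i \<le> j" "P i \<noteq> P j" for i j
    using that
  proof (induction rule: dec_induct)
    case (step n)
    then show ?case by (metis less_Suc_eq order_refl)
  qed auto
  show ?thesis
    using *[of i j] *[of j i] assms by (cases "i \<le> j") auto
qed

text \<open>The running coordinate changes by one in each step, so a path passing from at most
  \<open>z\<close> to beyond \<open>z\<close> traverses the edge at \<open>z\<close>.
  \<open>S\<close> is described by convexity and not by end points because a one-point path has no
  edges.\<close>

lemma bendless_path_edges:
  assumes "grid_path P" "bendless P"
  shows "\<exists>h c S. path_edges P = line_edge h c ` S \<and>
    (\<forall>x\<in>S. \<forall>y\<in>S. \<forall>z. x \<le> z \<longrightarrow> z \<le> y \<longrightarrow> z \<in> S)"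
proof -
  have main: ?thesis
    if g: "\<And>i. i < length P \<Longrightarrow> P ! i = (if h then (g i, c) else (c, g i))" for h c and g :: "nat \<Rightarrow> int"
  proof -
    define S where "S = {x. \<exists>i. Suc i < length P \<and> {g i, g (Suc i)} = {x, x + 1}}"
    have step: "\<bar>g i - g (Suc i)\<bar> = 1" if "Suc i < length P" for i
    proof -
      have "grid_adj (P ! i) (P ! Suc i)"
        using assms(1) that by (auto simp: grid_path_def)
      then show ?thesis
        using g[of i] g[of "Suc i"] that by (auto simp: grid_adj_def split: if_splits)
    qed
    have edge: "{P ! i, P ! Suc i} = line_edge h c (min (g i) (g (Suc i)))" if "Suc i < length P" for i
      using g[of i] g[of "Suc i"] step[OF that] that
      by (cases "g i < g (Suc i)") (auto simp: line_edge_def doubleton_eq_iff min_def)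
    have S: "S = {min (g i) (g (Suc i)) | i. Suc i < length P}"
    proof (intro set_eqI iffI)
      fix x assume "x \<in> S"
      then show "x \<in> {min (g i) (g (Suc i)) | i. Suc i < length P}"
        unfolding S_def by (auto simp: doubleton_eq_iff) (metis min.absorb1 min.absorb2 less_add_one order_less_imp_le)+
    next
      fix x assume "x \<in> {min (g i) (g (Suc i)) | i. Suc i < length P}"
      then obtain i where i: "x = min (g i) (g (Suc i))" "Suc i < length P" by blast
      have "{g i, g (Suc i)} = {x, x + 1}"
        using step[OF i(2)] i(1) by (cases "g i < g (Suc i)") (auto simp: doubleton_eq_iff min_def)
      then show "x \<in> S" using i(2) unfolding S_def by blast
    qed
    have "path_edges P = line_edge h c ` S"
      unfolding S path_edges_def image_Collect
      by (rule Collect_cong) (metis (no_types, lifting) edge)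
    moreover have "z \<in> S" if xy: "x \<in> S" "y \<in> S" "x \<le> z" "z \<le> y" for x y z
    proof (cases "z = y")
      case False
      obtain i j where i: "Suc i < length P" "{g i, g (Suc i)} = {x, x + 1}"
        and j: "Suc j < length P" "{g j, g (Suc j)} = {y, y + 1}"
        using xy unfolding S_def by blast
      obtain i' where i': "i' < length P" "g i' \<le> z"
        using i xy by (metis Suc_lessD doubleton_eq_iff)
      obtain j' where j': "j' < length P" "\<not> g j' \<le> z"
        using j xy False by (metis Suc_lessD doubleton_eq_iff le_less_trans linorder_not_le order_le_less)
      obtain k where k: "k < max i' j'" "(g k \<le> z) \<noteq> (g (Suc k) \<le> z)"
        using exists_crossing_step[of "\<lambda>k. g k \<le> z", OF i'(2) j'(2)] by blast
      have l: "Suc k < length P" using k i' j' by auto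
      have "{g k, g (Suc k)} = {z, z + 1}"
        using step[OF l] k(2) by (cases "g k \<le> z") (auto simp: doubleton_eq_iff)
      then show ?thesis using l unfolding S_def by blast
    qed (use xy in auto)
    ultimately show ?thesis by blast
  qed
  from assms(2) consider c where "\<forall>p\<in>set P. fst p = c" | c where "\<forall>p\<in>set P. snd p = c"
    unfolding bendless_def by blast
  then show ?thesis
  proof cases
    case (1 c)
    then show ?thesis
      by (intro main[of False "\<lambda>i. snd (P ! i)" c]) (auto simp: prod_eq_iff)
  next
    case (2 c)
    then show ?thesis
      by (intro main[of True "\<lambda>i. fst (P ! i)" c]) (auto simp: prod_eq_iff)
  qed
qed

text \<open>The vertices \<open>y\<^sub>1, y\<^sub>2, y\<^sub>3\<close> are an asteroidal triple: the middle one of their three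
  disjoint segments is crossed by the common neighbour of the other two.\<close>
lemma in_B0_imp_no_S3:
  assumes "in_B0 V E"
  shows "\<not> has_induced_copy S3_V S3_E V E"
proof
  assume "has_induced_copy S3_V S3_E V E"
  then obtain f where f: "inj_on f S3_V" "f ` S3_V \<subseteq> V"
    and adj: "\<And>a b. a \<in> S3_V \<Longrightarrow> b \<in> S3_V \<Longrightarrow> a \<noteq> b \<Longrightarrow> {f a, f b} \<in> E \<longleftrightarrow> {a, b} \<in> S3_E"
    unfolding has_induced_copy_def by blast
  from assms obtain P where P: "EPG_rep V E P" and bl: "\<And>v. v \<in> V \<Longrightarrow> bendless (P v)"
    unfolding in_B0_def by blast
  define R where "R v h c S \<longleftrightarrow> path_edges (P v) = line_edge h c ` S \<and>
      (\<forall>x\<in>S. \<forall>y\<in>S. \<forall>z. x \<le> z \<longrightarrow> z \<le> y \<longrightarrow> z \<in> S)" for v h c S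
  have "\<exists>h c S. R v h c S" if "v \<in> V" for v
    using bendless_path_edges[of "P v"] bl[OF that] P that unfolding EPG_rep_def R_def by blast
  then obtain h c S where R: "\<And>v. v \<in> V \<Longrightarrow> R v (h v) (c v) (S v)"
    by metis
  have rep: "path_edges (P v) = line_edge (h v) (c v) ` S v" if "v \<in> V" for v
    using R[OF that] by (simp add: R_def)
  have conv: "z \<in> S v" if "v \<in> V" "x \<in> S v" "y \<in> S v" "x \<le> z" "z \<le> y" for v x y z
    using R[OF that(1)] that(2-) unfolding R_def by blast
  define H C T where "H = (\<lambda>i. h (f i))" and "C = (\<lambda>i. c (f i))" and "T = (\<lambda>i. S (f i))"
  have A: "{a, b} \<in> S3_E \<longleftrightarrow> H a = H b \<and> C a = C b \<and> T a \<inter> T b \<noteq> {}"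
    if "a \<in> S3_V" "b \<in> S3_V" "a \<noteq> b" for a b
  proof -
    have "f a \<in> V" "f b \<in> V" "f a \<noteq> f b" using f that by (auto dest: inj_onD)
    then have "{f a, f b} \<in> E \<longleftrightarrow> path_edges (P (f a)) \<inter> path_edges (P (f b)) \<noteq> {}"
      using P unfolding EPG_rep_def by blast
    also have "\<dots> \<longleftrightarrow> H a = H b \<and> C a = C b \<and> T a \<inter> T b \<noteq> {}"
      using rep[OF \<open>f a \<in> V\<close>] rep[OF \<open>f b \<in> V\<close>]
      by (auto simp: line_edge_inject H_def C_def T_def)
    finally show ?thesis using adj[OF that] by simp
  qed
  have K: "z \<in> T a" if "a \<in> S3_V" "x \<in> T a" "y \<in> T a" "x \<le> z" "z \<le> y" for a x y z
    using conv[of "f a"] that f unfolding T_def by blast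
  have adj: "\<exists>x. H a = H b \<and> C a = C b \<and> x \<in> T a \<and> x \<in> T b"
    if "a \<in> S3_V" "b \<in> S3_V" "a \<noteq> b" "{a, b} \<in> S3_E" for a b
    using A[OF that(1-3)] that(4) by auto
  have V: "0 \<in> S3_V" "1 \<in> S3_V" "2 \<in> S3_V" "3 \<in> S3_V" "4 \<in> S3_V" "5 \<in> S3_V"
    by (auto simp: S3_V_def)
  \<comment> \<open>The points follow the outer hexagon \<open>y_1\<close>, \<open>x_2\<close>,
    \<open>y_2\<close>, \<open>x_3\<close>, \<open>y_3\<close>, \<open>x_1\<close>. Their existence
    also puts all six paths on one grid line.\<close>
  obtain p1 where p1: "H 3 = H 0" "C 3 = C 0" "p1 \<in> T 3" "p1 \<in> T 0"
    using adj[of 3 0] V by (auto simp: S3_E_def insert_commute)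
  obtain p2 where p2: "H 3 = H 1" "C 3 = C 1" "p2 \<in> T 3" "p2 \<in> T 1"
    using adj[of 3 1] V by (auto simp: S3_E_def insert_commute)
  obtain p3 where p3: "H 4 = H 1" "C 4 = C 1" "p3 \<in> T 4" "p3 \<in> T 1"
    using adj[of 4 1] V by (auto simp: S3_E_def insert_commute)
  obtain p4 where p4: "H 4 = H 2" "C 4 = C 2" "p4 \<in> T 4" "p4 \<in> T 2"
    using adj[of 4 2] V by (auto simp: S3_E_def insert_commute)
  obtain p5 where p5: "H 5 = H 2" "C 5 = C 2" "p5 \<in> T 5" "p5 \<in> T 2"
    using adj[of 5 2] V by (auto simp: S3_E_def insert_commute)
  obtain p6 where p6: "H 5 = H 0" "C 5 = C 0" "p6 \<in> T 5" "p6 \<in> T 0"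
    using adj[of 5 0] V by (auto simp: S3_E_def insert_commute)
  have nS: "{3, 4} \<notin> S3_E" "{4, 5} \<notin> S3_E" "{3, 5} \<notin> S3_E" "{0, 4} \<notin> S3_E" "{1, 5} \<notin> S3_E" "{2, 3} \<notin> S3_E"
    by (auto simp: S3_E_def doubleton_eq_iff)
  have d: "T 3 \<inter> T 4 = {}" "T 4 \<inter> T 5 = {}" "T 3 \<inter> T 5 = {}" "T 0 \<inter> T 4 = {}" "T 1 \<inter> T 5 = {}" "T 2 \<inter> T 3 = {}"
    using A[of 3 4] A[of 4 5] A[of 3 5] A[of 0 4] A[of 1 5] A[of 2 3] nS V p1 p2 p3 p4 p5 p6 by auto
  \<comment> \<open>A convex set that misses \<open>z\<close> lies on one side of it.\<close>
  have outer: "x < z \<longleftrightarrow> y < z"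
    if "a \<in> S3_V" "b \<in> S3_V" "T a \<inter> T b = {}" "x \<in> T a" "y \<in> T a" "z \<in> T b" for a b x y z
  proof -
    have "z \<notin> T a" using that by blast
    then show ?thesis using K[OF that(1,4,5), of z] K[OF that(1,5,4), of z] by linarith
  qed
  have n4: "(p1 < p3) = (p6 < p3)" using outer[of 0 4 p1 p6 p3] V d p1 p6 p3 by simp
  have n5: "(p2 < p5) = (p3 < p5)" using outer[of 1 5 p2 p3 p5] V d p2 p3 p5 by simp
  have n3: "(p4 < p1) = (p5 < p1)" using outer[of 2 3 p4 p5 p1] V d p4 p5 p1 by simp
  \<comment> \<open>Each of \<open>p1\<close>, \<open>p3\<close>, \<open>p5\<close> has the other
    two on the same side, which is impossible for three distinct integers.\<close>
  have "(p1 < p3) = (p5 < p3)" "(p1 < p5) = (p3 < p5)" "(p3 < p1) = (p5 < p1)"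
    using n4 n5 n3 outer[of 5 4 p5 p6 p3] outer[of 3 5 p1 p2 p5] outer[of 4 3 p3 p4 p1] V d p1 p2 p3 p4 p5 p6
    by (simp_all add: Int_commute)
  moreover have "p1 \<noteq> p3" "p3 \<noteq> p5" "p1 \<noteq> p5"
    using d p1 p3 p5 by auto
  ultimately show False by linarith
qed

section \<open>Maximal outerplanar graphs\<close>

text \<open>The values of \<open>f\<close> may have gaps, so vertices are renumbered by rank, and
  consecutive numbers become polygon sides. In the equivalence \<open>maximal\<close> of the locale,
  one direction is the noncrossing property, the other the maximality of the graph, applied through
  the drawing on the parabola.\<close>

lemma maximal_outerplanar_triangulation:
  assumes "maximal_outerplanar V E"
  obtains n g where "bij_betw g {..<n} V" "triangulation n (\<lambda>i k. {g i, g k} \<in> E)"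
proof -
  have G: "outerplanar V E" and max: "\<And>u v. u \<in> V \<Longrightarrow> v \<in> V \<Longrightarrow> u \<noteq> v \<Longrightarrow> {u, v} \<notin> E \<Longrightarrow>
      \<not> outerplanar V (insert {u, v} E)"
    using assms unfolding maximal_outerplanar_def by blast+
  have simple: "simple_graph V E" using G by (simp add: outerplanar_def)
  then have fin: "finite V" by (simp add: simple_graph_def)
  obtain f where nc: "noncrossing f V E"
    using no_theta_crossing_imp_noncrossing[OF simple] outerplanar_imp_no_theta_crossing[OF G] by blast
  then have inj: "inj_on f V" by (simp add: noncrossing_def)
  define n where "n = card (f ` V)"
  obtain h where h: "bij_betw h {..<n} (f ` V)" "strict_mono_on {..<n} h"
    unfolding n_def using ex_bij_betw_strict_mono_card[OF finite_imageI[OF fin, of f]] by blast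
  define g where "g = inv_into V f \<circ> h"
  have bij: "bij_betw g {..<n} V"
    using bij_betw_trans[OF h(1) bij_betw_inv_into[OF inj_on_imp_bij_betw[OF inj]]]
    by (simp add: g_def)
  have gV: "g i \<in> V" if "i < n" for i using bij that by (auto simp: bij_betw_def)
  have fg: "f (g i) = h i" if "i < n" for i
  proof -
    have "h i \<in> f ` V" using h(1) that by (auto simp: bij_betw_def)
    then show ?thesis by (simp add: g_def f_inv_into_f)
  qed
  have mono: "f (g i) < f (g k) \<longleftrightarrow> i < k" if "i < n" "k < n" for i k
    using strict_mono_on_less[OF h(2), of i k] that fg by simp
  have index: "\<exists>i<n. g i = v" if "v \<in> V" for v
    using bij that by (auto simp: bij_betw_def image_iff) 
  let ?A = "\<lambda>i k. {g i, g k} \<in> E"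
  have sym: "?A k i" if "?A i k" for i k using that by (simp add: insert_commute)
  have no_cross: "\<not> ?A c d" if ik: "?A i k" "i < k" "k < n" and c: "i < c" "c < k" and d: "d < n" "d < i \<or> k < d"
    for i k c d
  proof
    assume cd: "?A c d"
    from d(2) show False
    proof
      assume "d < i"
      then show False
        using noncrossingD[OF nc, of "g d" "g i" "g c" "g k"] ik c d(1) cd sym[OF cd] gV mono by simp
    next
      assume "k < d"
      then show False
        using noncrossingD[OF nc, of "g i" "g c" "g k" "g d"] ik c d(1) cd gV mono by simp
    qed
  qed
  have edge: "?A i k" if ik: "i < k" "k < n"
    and free: "\<And>c d. i < c \<Longrightarrow> c < k \<Longrightarrow> d < n \<Longrightarrow> d < i \<or> k < d \<Longrightarrow> \<not> ?A c d" for i k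
  proof (rule ccontr)
    assume no: "\<not> ?A i k"
    have V: "g i \<in> V" "g k \<in> V" using gV ik by auto
    have "f (g i) < f (g k)" using mono[of i k] ik by simp
    then have neq: "g i \<noteq> g k" by auto
    let ?E = "insert {g i, g k} E"
    have simple': "simple_graph V ?E"
      unfolding simple_graph_def
    proof (intro conjI ballI fin)
      fix e assume "e \<in> ?E"
      then show "\<exists>u v. u \<in> V \<and> v \<in> V \<and> u \<noteq> v \<and> e = {u, v}"
      proof
        assume "e = {g i, g k}"
        then show ?thesis using V neq by (intro exI[of _ "g i"] exI[of _ "g k"]) simp
      next
        assume "e \<in> E"
        then show ?thesis using simple by (simp add: simple_graph_def)
      qed
    qed
    have False if mem: "a \<in> V" "b \<in> V" "c \<in> V" "d \<in> V" and lt: "f a < f b" "f b < f c" "f c < f d"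
      and E: "{a, c} \<in> ?E" "{b, d} \<in> ?E" for a b c d
    proof -
      obtain a' b' c' d' where idx: "a' < n" "b' < n" "c' < n" "d' < n"
        and g: "a = g a'" "b = g b'" "c = g c'" "d = g d'"
        using index mem by metis
      have lt': "a' < b'" "b' < c'" "c' < d'" using lt mono idx g by auto
      have inj': "inj_on g {..<n}" using bij by (simp add: bij_betw_def)
      \<comment> \<open>Since indices are compared in increasing order, it is determined which end
        of the new chord is which.\<close>
      have pair: "p = i \<and> q = k" if "{g p, g q} = {g i, g k}" "p < q" "q < n" for p q
      proof -
        have "g p = g i \<and> g q = g k \<or> g p = g k \<and> g q = g i"
          using that(1) by (auto simp: doubleton_eq_iff)
        then have "p = i \<and> q = k \<or> p = k \<and> q = i"
          using inj_onD[OF inj'] that ik by (metis lessThan_iff less_trans)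
        then show ?thesis using that ik by auto
      qed
      consider "{a, c} \<in> E" "{b, d} \<in> E" | "{a, c} = {g i, g k}" "{b, d} = {g i, g k}"
        | "{a, c} = {g i, g k}" "{b, d} \<in> E" | "{a, c} \<in> E" "{b, d} = {g i, g k}"
        using E by blast
      then show False
      proof cases
        case 1
        then show False using noncrossingD[OF nc mem lt] by simp
      next
        case 2
        then show False using pair[of a' c'] pair[of b' d'] lt' idx g by simp
      next
        case 3
        then have "a' = i" "c' = k" using pair[of a' c'] lt' idx g by auto
        then show False using free[of b' d'] 3 lt' idx g by simp
      next
        \<comment> \<open>Here \<open>c\<close> is the end between \<open>i\<close> and
          \<open>k\<close> and \<open>a\<close> lies before \<open>i\<close>, so the edge is read
          backwards.\<close>
        case 4
        then have "b' = i" "d' = k" using pair[of b' d'] lt' idx g by auto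
        then show False using free[of c' a'] 4 lt' idx g by (simp add: insert_commute)
      qed
    qed
    then have "noncrossing f V ?E" using inj unfolding noncrossing_def by blast
    then have "outerplanar V ?E" by (rule noncrossing_imp_outerplanar[OF simple'])
    then show False using max[OF V neq] no by simp
  qed
  have "triangulation n ?A"
  proof
    show "?A k i" if "?A i k" for i k using sym[OF that] .
    show "i \<noteq> k" if "?A i k" for i k using simple_graph_edge(3)[OF simple that] by auto
    show "?A i k \<longleftrightarrow> (\<forall>c d. i < c \<longrightarrow> c < k \<longrightarrow> d < n \<longrightarrow> d < i \<or> k < d \<longrightarrow> \<not> ?A c d)"
      if "i < k" "k < n" for i k
      using no_cross[OF _ that] edge[OF that] by blast
  qed
  then show thesis using that bij by blast
qed

theorem theorem4p6:
  fixes V :: "'a set" and E :: "'a set set"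
  assumes "maximal_outerplanar V E"
  shows "in_B0 V E \<longleftrightarrow> \<not> has_induced_copy S3_V S3_E V E"
proof
  show "\<not> has_induced_copy S3_V S3_E V E" if "in_B0 V E"
    using in_B0_imp_no_S3[OF that] .
  obtain n g where "bij_betw g {..<n} V" "triangulation n (\<lambda>i k. {g i, g k} \<in> E)"
    using maximal_outerplanar_triangulation[OF assms] .
  then show "in_B0 V E" if "\<not> has_induced_copy S3_V S3_E V E"
    using triangulation_imp_in_B0 that by blast
qed

end
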